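(* We have $$\lim_{n \to \infty} \mathbb{P}\left( \tilde M_n = \tilde M_n^+ \right) = 1.$$ Thus, for any $\tau > 0$, $$\lim_{n \to \infty}\mathbb{P}\left( \tilde M_n \le \sqrt{\frac{n}{\tau}} \right) = \exp(-\tau).$$
   Context: For each $n \ge 1$, $U_1,\ldots,U_n$ are independent and identically distributed from the uniform distribution on $[0,1]$, with order statistics $U_{(1)} \le \cdots \le U_{(n)}$, and by convention $U_{(0)} = 0$. For $0 \le i < j \le n$, define (almost surely) $$\tilde M_{i,j} = \frac{j - i - n(U_{(j)} - U_{(i)})}{\sqrt{n(U_{(j)} - U_{(i)})(1 - U_{(j)} + U_{(i)})}}.$$ Define $$\tilde M_n^+ = \max_{0 \le i < j \le n:\ 1 \le j - i \le n}\tilde M_{i,j}, \qquad \tilde M_n^- = -\min_{0 \le i < j \le n:\ 1 \le j - i \le n}\tilde M_{i,j}, \qquad \tilde M_n = \max\{\tilde M_n^+, \tilde M_n^-\}.$$ *)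

theory Defs
  imports "HOL-Probability.Probability"
begin

text \<open>
  All notions are functions of a sample \<open>u 1, ..., u n\<close>; the statistics are obtained by
  plugging in \<open>u = (\<lambda>i. U n i \<omega>)\<close>.
\<close>

definition order_stat :: "nat \<Rightarrow> (nat \<Rightarrow> real) \<Rightarrow> nat \<Rightarrow> real" where
  "order_stat n u k = (if k = 0 then 0 else sort (map u [1..<n+1]) ! (k - 1))"

text \<open>
  For an i.i.d. uniform sample the denominator is almost surely positive for all
  \<open>i < j \<le> n\<close>, so the convention \<open>x / 0 = 0\<close> only matters on a null set.
\<close>

definition M_tilde_ij :: "nat \<Rightarrow> (nat \<Rightarrow> real) \<Rightarrow> nat \<Rightarrow> nat \<Rightarrow> real" where
  "M_tilde_ij n u i j =
     (real j - real i - real n * (order_stat n u j - order_stat n u i)) /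
     sqrt (real n * (order_stat n u j - order_stat n u i) *
           (1 - order_stat n u j + order_stat n u i))"

definition index_pairs :: "nat \<Rightarrow> (nat \<times> nat) set" where
  "index_pairs n = {(i, j). i < j \<and> j \<le> n \<and> 1 \<le> j - i \<and> j - i \<le> n}"

definition M_tilde_plus :: "nat \<Rightarrow> (nat \<Rightarrow> real) \<Rightarrow> real" where
  "M_tilde_plus n u = Max ((\<lambda>(i, j). M_tilde_ij n u i j) ` index_pairs n)"

definition M_tilde_minus :: "nat \<Rightarrow> (nat \<Rightarrow> real) \<Rightarrow> real" where
  "M_tilde_minus n u = - Min ((\<lambda>(i, j). M_tilde_ij n u i j) ` index_pairs n)"

definition M_tilde :: "nat \<Rightarrow> (nat \<Rightarrow> real) \<Rightarrow> real" where
  "M_tilde n u = max (M_tilde_plus n u) (M_tilde_minus n u)"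

end

theory Submission
  imports Defs "HOL-Real_Asymp.Real_Asymp"
begin

text \<open>
  A value of order \<open>sqrt n\<close> is reached only through a single short spacing. For \<open>j = i + 1\<close>, the
  event that the statistic exceeds \<open>sqrt (n / \<tau>)\<close> is, up to lower order terms, that the
  spacing is smaller than \<open>\<tau> / n\<^sup>2\<close>, and the probability that all of the first \<open>n\<close> spacings are at
  least \<open>s\<close> is exactly \<open>(1 - n s) ^ n\<close>. For \<open>j - i \<ge> 2\<close>, and for all negative deviations, the
  statistic is \<open>o (sqrt n)\<close> on an event of probability tending to 1: short windows of points are
  handled by a union bound excluding clusters of 3 and of 5 points, long ones by Hoeffding's
  inequality. Negative deviations reduce to positive ones, since replacing
  \<open>(k, D) = (j - i, U(j) - U(i))\<close> by \<open>(n - k, 1 - D)\<close> changes the sign of the statistic.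
\<close>

subsection \<open>Order statistics and spacings\<close>

text \<open>Why two cluster sizes: excluding \<open>r + 1\<close> points in a window of length
  \<open>t\<close> allows \<open>t\<close> just below order \<open>n powr (-1 - 1/r)\<close>. A
  window of \<open>k\<close> steps then has length at least about \<open>k t\<close>, which suffices
  for \<open>k\<close> up to just below \<open>n powr (1 - 1/r)\<close>. For \<open>r = 2\<close>
  this stops short of \<open>sqrt n\<close>, while empirical deviations take over only above
  \<open>sqrt n\<close>. The choice \<open>r = 4\<close> closes the gap, but says nothing about
  windows of two or three steps, which \<open>r = 2\<close> handles.

  The scale: a spacing \<open>D = \<tau> / n^2\<close> has statistic close to
  \<open>1 / sqrt (n D) = sqrt (n / \<tau>)\<close>, and \<open>s = \<tau> / n^2\<close> turns
  \<open>(1 - n s)^n\<close> into \<open>(1 - \<tau> / n)^n\<close>. The first limit uses the same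
  event at an arbitrarily large level: some spacing lies below it with probability near 1, and then
  the positive part dominates.

  Probabilities are estimated for the unordered sample, where independence and union bounds act
  directly.\<close>

text \<open>Any index set is allowed, so that coordinates can be removed one at a time. The clause
  \<open>s \<le> u a\<close> is the spacing from the conventional point \<open>U(0) = 0\<close>;
  there is no condition towards 1, which leaves exactly the first \<open>n\<close> spacings.\<close>

definition spaced :: "real \<Rightarrow> 'b set \<Rightarrow> ('b \<Rightarrow> real) \<Rightarrow> bool" where
  "spaced s I u \<longleftrightarrow> (\<forall>a\<in>I. s \<le> u a) \<and> (\<forall>a\<in>I. \<forall>b\<in>I. a \<noteq> b \<longrightarrow> s \<le> \<bar>u a - u b\<bar>)"

text \<open>Index sets instead of consecutive ranks make a union bound over \<open>r\<close>-subsets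
  possible.\<close>

definition cluster :: "nat \<Rightarrow> real \<Rightarrow> 'b set \<Rightarrow> ('b \<Rightarrow> real) \<Rightarrow> bool" where
  "cluster r t I u \<longleftrightarrow> (\<exists>B\<subseteq>I. card B = r \<and> (\<forall>a\<in>B. \<forall>b\<in>B. \<bar>u a - u b\<bar> < t))"

lemma order_stat_0 [simp]: "order_stat n u 0 = 0"
  by (simp add: order_stat_def)

text \<open>Sorting permutes the list; the shift between list positions from 0 and ranks from 1 is
  composed with that permutation. Ties are harmless, since only existence of \<open>\<sigma>\<close>
  is claimed.\<close>

lemma order_stat_bij:
  obtains \<sigma> where "bij_betw \<sigma> {1..n} {1..n}" "\<And>k. k \<in> {1..n} \<Longrightarrow> order_stat n u k = u (\<sigma> k)"
proof -
  let ?ys = "map u [1..<n+1]"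
  obtain p where p: "p permutes {..<length ?ys}" "permute_list p ?ys = sort ?ys"
    using mset_eq_permutation[of "sort ?ys" ?ys] by auto
  have p1: "p permutes {..<n}" using p(1) by (simp del: upt_Suc)
  have bp: "bij_betw p {..<n} {..<n}" using permutes_imp_bij[OF p1] .
  have b1: "bij_betw (\<lambda>k. k - 1) {1..n} {..<n}"
    by (rule bij_betwI[where g = Suc]) auto
  have b2: "bij_betw Suc {..<n} {1..n}"
    by (rule bij_betwI[where g = "\<lambda>k. k - 1"]) auto
  have "bij_betw (Suc \<circ> (p \<circ> (\<lambda>k. k - 1))) {1..n} {1..n}"
    by (intro bij_betw_trans[OF bij_betw_trans[OF b1 bp] b2])
  moreover have "order_stat n u k = u ((Suc \<circ> (p \<circ> (\<lambda>k. k - 1))) k)" if "k \<in> {1..n}" for k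
  proof -
    have "k - 1 < n" using that by auto
    then have *: "p (k - 1) < n" using bp by (auto simp: bij_betw_def)
    have "order_stat n u k = permute_list p ?ys ! (k - 1)"
      using that p by (simp add: order_stat_def)
    also have "\<dots> = ?ys ! p (k - 1)"
      using p(1) \<open>k - 1 < n\<close> by (subst permute_list_nth) auto
    also have "\<dots> = u (Suc (p (k - 1)))"
      using * by (simp del: upt_Suc)
    finally show ?thesis by simp
  qed
  ultimately show ?thesis using that by blast
qed

lemma order_stat_mono:
  assumes "1 \<le> i" "i \<le> j" "j \<le> n"
  shows "order_stat n u i \<le> order_stat n u j"
  using assms by (auto simp: order_stat_def simp del: upt_Suc intro!: sorted_nth_mono)

lemma order_stat_in:
  assumes "\<And>a. a \<in> {1..n} \<Longrightarrow> u a \<in> S" "1 \<le> k" "k \<le> n"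
  shows "order_stat n u k \<in> S"
proof -
  obtain \<sigma> where \<sigma>: "bij_betw \<sigma> {1..n} {1..n}" "\<And>k. k \<in> {1..n} \<Longrightarrow> order_stat n u k = u (\<sigma> k)"
    using order_stat_bij[of n u] by blast
  then show ?thesis using assms by (metis atLeastAtMost_iff bij_betwE)
qed

lemma order_stat_mono':
  assumes "\<And>a. a \<in> {1..n} \<Longrightarrow> 0 \<le> u a" "i \<le> j" "j \<le> n"
  shows "order_stat n u i \<le> order_stat n u j"
proof (cases "i = 0")
  case True
  show ?thesis
  proof (cases "j = 0")
    case False
    then have "order_stat n u j \<in> {0..}" using assms by (intro order_stat_in) auto
    then show ?thesis using True by simp
  qed (use True in auto)
qed (use assms order_stat_mono in auto)

text \<open>\<open>\<sigma>\<close> maps the ranks with value at most \<open>y\<close> onto the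
  indices with value at most \<open>y\<close>, and by monotonicity those ranks form an initial
  segment. This duality serves both the deviation bound and measurability.\<close>

lemma order_stat_le_iff:
  assumes "1 \<le> k" "k \<le> n"
  shows "order_stat n u k \<le> y \<longleftrightarrow> k \<le> card {a\<in>{1..n}. u a \<le> y}"
proof -
  obtain \<sigma> where \<sigma>: "bij_betw \<sigma> {1..n} {1..n}" "\<And>k. k \<in> {1..n} \<Longrightarrow> order_stat n u k = u (\<sigma> k)"
    using order_stat_bij[of n u] by blast
  have "\<sigma> ` {k\<in>{1..n}. order_stat n u k \<le> y} = {a\<in>{1..n}. u a \<le> y}"
  proof -
    have "{a\<in>{1..n}. u a \<le> y} = {a \<in> \<sigma> ` {1..n}. u a \<le> y}" using \<sigma>(1) by (simp add: bij_betw_def)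
    also have "\<dots> = \<sigma> ` {k\<in>{1..n}. u (\<sigma> k) \<le> y}" by blast
    also have "{k\<in>{1..n}. u (\<sigma> k) \<le> y} = {k\<in>{1..n}. order_stat n u k \<le> y}"
      using \<sigma>(2) by (intro Collect_cong conj_cong) simp_all
    finally show ?thesis by (rule sym)
  qed
  moreover have "inj_on \<sigma> {k\<in>{1..n}. order_stat n u k \<le> y}"
    using \<sigma>(1) by (auto simp: bij_betw_def intro: inj_on_subset)
  ultimately have c: "card {a\<in>{1..n}. u a \<le> y} = card {k\<in>{1..n}. order_stat n u k \<le> y}"
    using card_image by fastforce
  show ?thesis
  proof
    assume "order_stat n u k \<le> y"
    moreover have "order_stat n u l \<le> order_stat n u k" if "l \<in> {1..k}" for l
      using that assms by (intro order_stat_mono) auto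
    ultimately have "{1..k} \<subseteq> {k\<in>{1..n}. order_stat n u k \<le> y}"
      using assms by fastforce
    from card_mono[OF _ this] show "k \<le> card {a\<in>{1..n}. u a \<le> y}" using c by simp
  next
    assume k: "k \<le> card {a\<in>{1..n}. u a \<le> y}"
    show "order_stat n u k \<le> y"
    proof (rule ccontr)
      assume n: "\<not> order_stat n u k \<le> y"
      have "{k\<in>{1..n}. order_stat n u k \<le> y} \<subseteq> {1..<k}"
      proof safe
        fix l assume l: "l \<in> {1..n}" "order_stat n u l \<le> y"
        then have "\<not> k \<le> l" using order_stat_mono[of k l n u] n assms by auto
        then show "l \<in> {1..<k}" using l by auto
      qed
      from card_mono[OF _ this] show False using c k assms by simp
    qed
  qed
qed

lemma spacing_chain:
  fixes x :: "nat \<Rightarrow> real"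
  assumes "\<And>i. i < n \<Longrightarrow> s \<le> x (Suc i) - x i" "i \<le> j" "j \<le> n"
  shows "real (j - i) * s \<le> x j - x i"
  using assms(2,3)
proof (induction j rule: dec_induct)
  case (step m)
  then show ?case using assms(1)[of m] by (simp add: Suc_diff_le algebra_simps)
qed auto

text \<open>Distinct sample points occupy distinct ranks, so their distance is a sum of consecutive
  spacings. This replaces an event on order statistics by one whose probability can be
  computed.\<close>

lemma spaced_iff_spacings:
  assumes "s > 0"
  shows "spaced s {1..n} u \<longleftrightarrow> (\<forall>i<n. s \<le> order_stat n u (Suc i) - order_stat n u i)"
proof -
  obtain \<sigma> where \<sigma>: "bij_betw \<sigma> {1..n} {1..n}" "\<And>k. k \<in> {1..n} \<Longrightarrow> order_stat n u k = u (\<sigma> k)"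
    using order_stat_bij[of n u] by blast
  show ?thesis
  proof (intro iffI allI impI)
    fix i assume sp: "spaced s {1..n} u" and i: "i < n"
    show "s \<le> order_stat n u (Suc i) - order_stat n u i"
    proof (cases "i = 0")
      case True
      have "order_stat n u 1 \<in> {s..}" using sp i by (intro order_stat_in) (auto simp: spaced_def)
      then show ?thesis using True by simp
    next
      case False
      have "\<sigma> (Suc i) \<in> {1..n}" "\<sigma> i \<in> {1..n}" "\<sigma> (Suc i) \<noteq> \<sigma> i"
        using bij_betw_apply[OF \<sigma>(1)] bij_betw_imp_inj_on[OF \<sigma>(1)] i False
        by (auto dest: inj_onD)
      then have "s \<le> \<bar>u (\<sigma> (Suc i)) - u (\<sigma> i)\<bar>"
        using sp by (auto simp: spaced_def)
      then show ?thesis using \<sigma>(2)[of i] \<sigma>(2)[of "Suc i"] i False order_stat_mono[of i "Suc i" n u] by auto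
    qed
  next
    assume h: "\<forall>i<n. s \<le> order_stat n u (Suc i) - order_stat n u i"
    have d: "s \<le> order_stat n u l - order_stat n u k" if "k < l" "l \<le> n" for k l
    proof -
      have "real (l - k) * s \<le> order_stat n u l - order_stat n u k"
        by (rule spacing_chain[of n]) (use h that in auto)
      moreover have "s \<le> real (l - k) * s" using that assms by simp
      ultimately show ?thesis by linarith
    qed
    have inv: "\<exists>k\<in>{1..n}. a = \<sigma> k" if "a \<in> {1..n}" for a
      using that \<sigma>(1) unfolding bij_betw_def by blast
    show "spaced s {1..n} u"
      unfolding spaced_def
    proof (intro conjI ballI impI)
      fix a assume "a \<in> {1..n}"
      with inv obtain k where "k \<in> {1..n}" "a = \<sigma> k" by blast
      \<comment> \<open>Rank 0 is the point 0, so the gap from rank 0 to rank \<open>k\<close> is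
        \<open>u a\<close> itself.\<close>
      then show "s \<le> u a" using \<sigma>(2)[of k] d[of 0 k] by auto
    next
      fix a b assume "a \<in> {1..n}" "b \<in> {1..n}" "a \<noteq> b"
      with inv obtain k l where kl: "k \<in> {1..n}" "a = \<sigma> k" "l \<in> {1..n}" "b = \<sigma> l" "k \<noteq> l" by metis
      then show "s \<le> \<bar>u a - u b\<bar>"
        using \<sigma>(2)[of k] \<sigma>(2)[of l] d[of k l] d[of l k] by (cases "k < l") auto
    qed
  qed
qed

text \<open>Otherwise the \<open>r + 1\<close> sample points of ranks \<open>i\<close> to
  \<open>i + r\<close> would form a cluster. Rank 0 is excluded because it is not a sample
  point.\<close>

lemma window_ge_if_no_cluster:
  assumes "\<not> cluster (Suc r) t {1..n} u" "1 \<le> i" "i + r \<le> n"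
  shows "t \<le> order_stat n u (i + r) - order_stat n u i"
proof (rule ccontr)
  assume lt: "\<not> ?thesis"
  obtain \<sigma> where \<sigma>: "bij_betw \<sigma> {1..n} {1..n}" "\<And>k. k \<in> {1..n} \<Longrightarrow> order_stat n u k = u (\<sigma> k)"
    using order_stat_bij[of n u] by blast
  have sub: "{i..i+r} \<subseteq> {1..n}" using assms by auto
  have "card (\<sigma> ` {i..i+r}) = Suc r"
    using \<sigma>(1) sub by (subst card_image) (auto simp: bij_betw_def intro: inj_on_subset)
  moreover have "\<sigma> ` {i..i+r} \<subseteq> {1..n}" using \<sigma>(1) sub by (auto simp: bij_betw_def)
  moreover have "\<bar>u (\<sigma> k) - u (\<sigma> l)\<bar> < t" if "k \<in> {i..i+r}" "l \<in> {i..i+r}" for k l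
  proof -
    have "order_stat n u m \<in> {order_stat n u i..order_stat n u (i+r)}" if "m \<in> {i..i+r}" for m
      using that assms by (auto intro: order_stat_mono)
    from this[OF that(1)] this[OF that(2)] show ?thesis
      using lt \<sigma>(2)[of k] \<sigma>(2)[of l] that assms by auto
  qed
  ultimately have "cluster (Suc r) t {1..n} u"
    unfolding cluster_def by (intro exI[of _ "\<sigma> ` {i..i+r}"]) auto
  then show False using assms by simp
qed

text \<open>Chaining \<open>m div r\<close> blocks of \<open>r\<close> steps makes the bound linear
  in \<open>m\<close>.\<close>

lemma window_div_le:
  assumes "\<not> cluster (Suc r) t {1..n} u" "1 \<le> i" "i + m \<le> n"
  shows "real (m div r) * t \<le> order_stat n u (i + m) - order_stat n u i"
proof -
  have *: "real q * t \<le> order_stat n u (i + q * r) - order_stat n u i" if "i + q * r \<le> n" for q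
    using that
  proof (induction q)
    case (Suc q)
    have "real q * t \<le> order_stat n u (i + q * r) - order_stat n u i"
      using Suc by simp
    moreover have "t \<le> order_stat n u (i + q * r + r) - order_stat n u (i + q * r)"
      using Suc.prems by (intro window_ge_if_no_cluster assms(1)) (use assms in \<open>auto simp: algebra_simps\<close>)
    ultimately show ?case by (simp add: algebra_simps)
  qed simp
  have "m div r * r \<le> m" by simp
  then have "order_stat n u (i + m div r * r) \<le> order_stat n u (i + m)"
    using assms by (intro order_stat_mono) auto
  then show ?thesis using *[of "m div r"] \<open>m div r * r \<le> m\<close> assms by linarith
qed

text \<open>Counts are controlled only at the grid points \<open>l / n\<close>; rounding
  \<open>n * order_stat n u j\<close> to an integer costs the extra 1.\<close>

lemma order_stat_deviation:
  assumes "n \<ge> 1" and u: "\<And>a. a \<in> {1..n} \<Longrightarrow> 0 \<le> u a \<and> u a \<le> 1"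
    and dev: "\<And>l. l \<le> n \<Longrightarrow> \<bar>real (card {a\<in>{1..n}. u a \<le> real l / real n}) - real l\<bar> \<le> c"
    and "j \<le> n"
  shows "\<bar>real n * order_stat n u j - real j\<bar> \<le> c + 1"
proof (cases "j = 0")
  case True
  then show ?thesis using dev[of 0] by simp
next
  case False
  define x where "x = order_stat n u j"
  have x: "0 \<le> x" "x \<le> 1"
    using order_stat_in[of n u "{0..1}" j] False assms by (auto simp: x_def)
  have up: "real j \<le> real n * x + 1 + c"
  proof -
    have "0 \<le> real n * x" using x by simp
    define l where "l = nat \<lceil>real n * x\<rceil>"
    have l: "real n * x \<le> real l" "real l \<le> real n * x + 1"
      using \<open>0 \<le> real n * x\<close> unfolding l_def by linarith+
    have "l \<le> n" using x unfolding l_def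
      by (metis ceiling_le_iff mult_left_le nat_le_iff of_int_of_nat_eq of_nat_0_le_iff)
    have "x \<le> real l / real n" using l assms by (simp add: field_simps)
    then have "j \<le> card {a\<in>{1..n}. u a \<le> real l / real n}"
      using order_stat_le_iff[of j n u "real l / real n"] False assms by (simp add: x_def)
    then show ?thesis using dev[OF \<open>l \<le> n\<close>] l by linarith
  qed
  have low: "real n * x \<le> real j + c + 1"
  proof (cases "x = 0")
    case True then show ?thesis using dev[of 0] by simp
  next
    case x0: False
    \<comment> \<open>Rounding strictly downwards puts \<open>l / n\<close> below \<open>x\<close>,
      so fewer than \<open>j\<close> points lie at or below it. This requires
      \<open>x > 0\<close>.\<close>
    define l where "l = nat (\<lceil>real n * x\<rceil> - 1)"
    have "real n * x > 0" using x0 x assms by simp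
    then have l: "real n * x \<le> real l + 1" "real l < real n * x"
      unfolding l_def by linarith+
    have "real n * x \<le> real n" using x by (simp add: mult_left_le)
    then have "l \<le> n" using l by linarith
    have "\<not> x \<le> real l / real n" using l assms by (simp add: field_simps)
    then have "\<not> j \<le> card {a\<in>{1..n}. u a \<le> real l / real n}"
      using order_stat_le_iff[of j n u "real l / real n"] False assms by (simp add: x_def)
    then show ?thesis using dev[OF \<open>l \<le> n\<close>] l by linarith
  qed
  show ?thesis using up low by (simp add: x_def abs_le_iff)
qed

subsection \<open>Deterministic bounds\<close>

text \<open>Abstract \<open>k\<close> and \<open>D\<close> permit two applications, to
  \<open>(j - i, D)\<close> and to the complementary \<open>(n - (j - i), 1 - D)\<close>. The
  constants 10 and 32 are those available for the complement.\<close>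

lemma ratio_bound_eventually:
  fixes \<epsilon> :: real
  assumes "\<epsilon> > 0"
  shows "\<forall>\<^sub>F n in sequentially. \<forall>k D. k \<le> n \<and> 0 < D \<and> D < 1
    \<and> \<bar>real k - real n * D\<bar> \<le> 4 * real n powr 0.7 \<and> real n powr (-1.6) \<le> D
    \<and> (10 \<le> k \<longrightarrow> real k * real n powr (-1.27) / 32 \<le> D)
    \<longrightarrow> (real k - real n * D) / sqrt (real n * D * (1 - D)) \<le> \<epsilon> * sqrt (real n)"
proof -
  have "\<forall>\<^sub>F n in sequentially. 8 * real n powr 0.7 \<le> \<epsilon>\<^sup>2 * real n"
    using assms by real_asymp
  moreover have "\<forall>\<^sub>F n in sequentially. 200 \<le> \<epsilon>\<^sup>2 * (real n)\<^sup>2 * real n powr (-1.6)"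
    using assms by real_asymp
  moreover have "\<forall>\<^sub>F n in sequentially. 64 * real n powr 0.72 \<le> \<epsilon>\<^sup>2 * (real n)\<^sup>2 * real n powr (-1.27)"
    using assms by real_asymp
  moreover have "\<forall>\<^sub>F n in sequentially. 8 * real n powr 0.7 \<le> real n powr 0.72"
    by real_asymp
  moreover have "\<forall>\<^sub>F n in sequentially. 64 * (real n powr 0.7)\<^sup>2 \<le> \<epsilon>\<^sup>2 * (real n * real n powr 0.72)"
    using assms by real_asymp
  moreover have "\<forall>\<^sub>F n::nat in sequentially. n \<ge> 1" by (rule eventually_ge_at_top)
  ultimately show ?thesis
  proof eventually_elim
    case (elim n)
    show ?case
    proof (intro allI impI; elim conjE)
      fix k :: nat and D :: real
      assume k: "k \<le> n" and D: "0 < D" "D < 1" and dev: "\<bar>real k - real n * D\<bar> \<le> 4 * real n powr 0.7"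
        and D2: "real n powr (-1.6) \<le> D" and D4: "10 \<le> k \<longrightarrow> real k * real n powr (-1.27) / 32 \<le> D"
      define z where "z = real k - real n * D"
      have n: "real n > 0" using elim by simp
      have "0 \<le> \<epsilon>\<^sup>2" by simp
      have main: "z\<^sup>2 \<le> \<epsilon>\<^sup>2 * (real n)\<^sup>2 * (D * (1 - D))" if z0: "0 < z"
      proof (cases "D > 1/2")
        case True
        \<comment> \<open>One factor \<open>z\<close> is bounded through \<open>k \<le> n\<close>,
          which supplies the possibly tiny \<open>1 - D\<close>; the other one by the
          deviation.\<close>
        have "z \<le> real n * (1 - D)" using k by (simp add: z_def algebra_simps)
        moreover have "z \<le> 4 * real n powr 0.7" using dev by (simp add: z_def)
        ultimately have "z * z \<le> (4 * real n powr 0.7) * (real n * (1 - D))"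
          using z0 by (intro mult_mono) auto
        also have "\<dots> \<le> (\<epsilon>\<^sup>2 * real n / 2) * (real n * (1 - D))"
          using elim D by (intro mult_right_mono) auto
        also have "\<dots> = \<epsilon>\<^sup>2 * (real n)\<^sup>2 * ((1/2) * (1 - D))" by (simp add: power2_eq_square)
        also have "\<dots> \<le> \<epsilon>\<^sup>2 * (real n)\<^sup>2 * (D * (1 - D))"
          using True D by (intro mult_left_mono mult_right_mono) auto
        finally show ?thesis by (simp add: power2_eq_square)
      next
        case False
        have zk: "z \<le> real k" using D n by (simp add: z_def)
        \<comment> \<open>Now \<open>1 - D\<close> is at least 1/2, and three ranges of
          \<open>k\<close> use three different lower bounds for \<open>D\<close>.\<close>
        have "2 * z\<^sup>2 \<le> \<epsilon>\<^sup>2 * (real n)\<^sup>2 * D"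
        proof (cases "k < 10")
          case True
          have "z\<^sup>2 \<le> 10\<^sup>2" using zk z0 True by (intro power_mono) auto
          also have "2 * (10::real)\<^sup>2 \<le> \<epsilon>\<^sup>2 * (real n)\<^sup>2 * real n powr (-1.6)" using elim by simp
          also have "\<dots> \<le> \<epsilon>\<^sup>2 * (real n)\<^sup>2 * D" using D2 by (intro mult_left_mono) auto
          finally show ?thesis by simp
        next
          case k10: False
          show ?thesis
          proof (cases "real k \<le> real n powr 0.72")
            case True
            \<comment> \<open>The right-hand side contains
              \<open>n^2 * n powr (-1.27) = n powr 0.73\<close>, which beats the cutoff
              \<open>n powr 0.72\<close>.\<close>
            have "z * z \<le> real k * real n powr 0.72" using zk z0 True by (intro mult_mono) auto
            also have "2 * \<dots> \<le> real k * ((\<epsilon>\<^sup>2 * (real n)\<^sup>2 * real n powr (-1.27)) / 32)"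
              using elim(3) mult_left_mono[of "64 * real n powr 0.72" "\<epsilon>\<^sup>2 * (real n)\<^sup>2 * real n powr (-1.27)" "real k / 32"] by simp
            also have "\<dots> = \<epsilon>\<^sup>2 * (real n)\<^sup>2 * (real k * real n powr (-1.27) / 32)" by simp
            also have "\<dots> \<le> \<epsilon>\<^sup>2 * (real n)\<^sup>2 * D" using D4 k10 by (intro mult_left_mono) auto
            finally show ?thesis by (simp add: power2_eq_square)
          next
            case kbig: False
            \<comment> \<open>Above the cutoff, the deviation \<open>4 * n powr 0.7\<close> takes at
              most half of \<open>n powr 0.72\<close>.\<close>
            have nD: "real n powr 0.72 / 2 \<le> real n * D"
              using kbig dev elim(4) by (simp add: abs_le_iff)
            have "z\<^sup>2 \<le> (4 * real n powr 0.7)\<^sup>2" using dev z0 by (intro power_mono) (auto simp: z_def)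
            also have "2 * (4 * real n powr 0.7)\<^sup>2 = 64 * (real n powr 0.7)\<^sup>2 / 2"
              by (simp add: power_mult_distrib)
            also have "\<dots> \<le> \<epsilon>\<^sup>2 * (real n * real n powr 0.72) / 2"
              using elim(5) by simp
            also have "\<dots> = \<epsilon>\<^sup>2 * real n * (real n powr 0.72 / 2)" by simp
            also have "\<dots> \<le> \<epsilon>\<^sup>2 * real n * (real n * D)" using nD by (intro mult_left_mono) auto
            finally show ?thesis by (simp add: power2_eq_square mult.assoc)
          qed
        qed
        also have "\<dots> = 2 * (\<epsilon>\<^sup>2 * (real n)\<^sup>2 * (D * (1/2)))" by simp
        also have "\<dots> \<le> 2 * (\<epsilon>\<^sup>2 * (real n)\<^sup>2 * (D * (1 - D)))"
          using False D by (intro mult_left_mono) auto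
        finally show ?thesis by simp
      qed
      have pos: "real n * D * (1 - D) > 0" using n D by simp
      have "z \<le> \<epsilon> * sqrt (real n) * sqrt (real n * D * (1 - D))"
      proof (cases "0 < z")
        case True
        have "z = sqrt (z\<^sup>2)" using True by simp
        also have "\<dots> \<le> sqrt (\<epsilon>\<^sup>2 * (real n)\<^sup>2 * (D * (1 - D)))"
          using main[OF True] by (rule real_sqrt_le_mono)
        also have "\<dots> = sqrt (\<epsilon>\<^sup>2 * (real n * (real n * D * (1 - D))))"
          by (simp add: power2_eq_square mult_ac)
        also have "\<dots> = \<epsilon> * sqrt (real n) * sqrt (real n * D * (1 - D))"
          using assms by (simp only: real_sqrt_mult real_sqrt_abs abs_of_pos mult.assoc)
        finally show ?thesis .
      next
        case False
        have "0 \<le> \<epsilon> * sqrt (real n) * sqrt (real n * D * (1 - D))" using assms pos by simp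
        then show ?thesis using False by linarith
      qed
      then show "(real k - real n * D) / sqrt (real n * D * (1 - D)) \<le> \<epsilon> * sqrt (real n)"
        using pos by (simp add: z_def pos_divide_le_eq)
    qed
  qed
qed

text \<open>
  The exponents are chosen as follows. The union bound for clusters of \<open>r + 1\<close> points of diameter
  \<open>t\<close> is of order \<open>n ^ (r + 1) t ^ r\<close>, so it tends to 0 for \<open>r = 2\<close>, \<open>t = n powr (-1.6)\<close> and for
  \<open>r = 4\<close>, \<open>t = n powr (-1.27)\<close>. The latter controls windows of up to about \<open>n powr 0.73\<close>
  points, and the empirical deviation \<open>n powr 0.7\<close> controls the larger ones. The last conjunct
  only rules out ties.
\<close>

definition good_sample :: "nat \<Rightarrow> (nat \<Rightarrow> real) \<Rightarrow> bool" where
  "good_sample n u \<longleftrightarrow>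
     (\<forall>a\<in>{1..n}. real n powr (-1.6) \<le> u a \<and> u a \<le> 1 - real n powr (-1.6)) \<and>
     \<not> cluster 3 (real n powr (-1.6)) {1..n} u \<and>
     \<not> cluster 5 (real n powr (-1.27)) {1..n} u \<and>
     (\<forall>l\<le>n. \<bar>real (card {a\<in>{1..n}. u a \<le> real l / real n}) - real l\<bar> \<le> real n powr 0.7) \<and>
     spaced (1 / real n ^ 3) {1..n} u"

section \<open>Windows in a good sample and their complements\<close>

text \<open>Rank 0 escapes the cluster conditions. In the first bound the distance of all points
  from 0 covers it; in the second the window is shortened by one step, to start at rank 1.\<close>

lemma good_sample_window:
  assumes "good_sample n u" "n \<ge> 1" "i < j" "j \<le> n"
  shows "2 \<le> j - i \<Longrightarrow> real n powr (-1.6) \<le> order_stat n u j - order_stat n u i"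
    and "5 \<le> j - i \<Longrightarrow> real (j - i) * real n powr (-1.27) / 16 \<le> order_stat n u j - order_stat n u i"
proof -
  define t where "t = real n powr (-1.6)"
  define t' where "t' = real n powr (-1.27)"
  have u: "\<And>a. a \<in> {1..n} \<Longrightarrow> t \<le> u a" and c3: "\<not> cluster (Suc 2) t {1..n} u"
    and c5: "\<not> cluster (Suc 4) t' {1..n} u"
    using assms(1) by (auto simp: good_sample_def t_def t'_def)
  have t: "t \<ge> 0" "t' \<ge> 0" by (auto simp: t_def t'_def)
  have u0: "\<And>a. a \<in> {1..n} \<Longrightarrow> 0 \<le> u a" using u t by fastforce
  note mono = order_stat_mono'[OF u0]
  have x1: "t \<le> order_stat n u m" if "1 \<le> m" "m \<le> n" for m
    using order_stat_in[of n u "{t..}" m] u that by auto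
  have "t \<le> order_stat n u j - order_stat n u i" if "2 \<le> j - i"
  proof (cases "i = 0")
    case True then show ?thesis using x1[of j] assms by simp
  next
    case False
    have "t \<le> order_stat n u (i + 2) - order_stat n u i"
      by (rule window_ge_if_no_cluster[OF c3]) (use False that assms in auto)
    moreover have "order_stat n u (i + 2) \<le> order_stat n u j"
      using that assms by (intro mono) auto
    ultimately show ?thesis by linarith
  qed
  then show "2 \<le> j - i \<Longrightarrow> real n powr (-1.6) \<le> order_stat n u j - order_stat n u i"
    by (simp add: t_def)
  have "real (j - i) * t' / 16 \<le> order_stat n u j - order_stat n u i" if "5 \<le> j - i"
  proof -
    define i' where "i' = max 1 i"
    define m where "m = j - i'"
    have i': "1 \<le> i'" "i \<le> i'" "i' + m = j" "j - i \<le> Suc m" "4 \<le> m"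
      using that by (auto simp: i'_def m_def)
    have "1 \<le> m div 4" using i'(5) by (simp add: div_greater_zero_iff Suc_le_eq)
    moreover have "m < 4 * (m div 4) + 4"
      using mult_div_mod_eq[of 4 m] mod_less_divisor[of 4 m] by linarith
    \<comment> \<open>With \<open>q = m div 4 \<ge> 1\<close>,
      \<open>j - i \<le> m + 1 \<le> 4 q + 4 \<le> 8 q\<close>; the constant 16 is generous.\<close>
    ultimately have "j - i \<le> 16 * (m div 4)" using i'(4) by linarith
    then have "real (j - i) \<le> 16 * real (m div 4)"
      by (metis of_nat_le_iff of_nat_mult of_nat_numeral)
    then have "real (j - i) * t' \<le> (16 * real (m div 4)) * t'"
      using t by (intro mult_right_mono) auto
    moreover have "real (m div 4) * t' \<le> order_stat n u j - order_stat n u i'"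
      using window_div_le[OF c5, of i' m] i' assms by simp
    moreover have "order_stat n u i \<le> order_stat n u i'"
      using i' assms by (intro mono) auto
    ultimately show ?thesis by linarith
  qed
  then show "5 \<le> j - i \<Longrightarrow> real (j - i) * real n powr (-1.27) / 16 \<le> order_stat n u j - order_stat n u i"
    by (simp add: t'_def)
qed

text \<open>The complement of a window contains an initial piece of \<open>i\<close> steps, up to
  \<open>U(i)\<close>, and a final piece of \<open>n - j\<close> steps, from \<open>U(j)\<close> to
  \<open>U(n)\<close>. The longer one has at least half of the \<open>n - (j - i)\<close> steps,
  which turns the thresholds 5 and 16 into 10 and 32.\<close>

lemma good_sample_bounds:
  assumes "good_sample n u" "n \<ge> 1" "i < j" "j \<le> n"
  defines "D \<equiv> order_stat n u j - order_stat n u i"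
  shows "0 < D" "D < 1" "\<bar>real (j - i) - real n * D\<bar> \<le> 4 * real n powr 0.7"
    and "real n powr (-1.6) \<le> 1 - D"
    and "10 \<le> n - (j - i) \<Longrightarrow> real (n - (j - i)) * real n powr (-1.27) / 32 \<le> 1 - D"
proof -
  define t where "t = real n powr (-1.6)"
  define t' where "t' = real n powr (-1.27)"
  have u: "\<And>a. a \<in> {1..n} \<Longrightarrow> t \<le> u a \<and> u a \<le> 1 - t"
    using assms(1) by (auto simp: good_sample_def t_def)
  have t: "t > 0" "t' \<ge> 0" using assms by (auto simp: t_def t'_def)
  have u0: "\<And>a. a \<in> {1..n} \<Longrightarrow> 0 \<le> u a \<and> u a \<le> 1" using u t by fastforce
  have mono: "k \<le> l \<Longrightarrow> l \<le> n \<Longrightarrow> order_stat n u k \<le> order_stat n u l" for k l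
    by (rule order_stat_mono') (use u0 in auto)
  have xm: "t \<le> order_stat n u m \<and> order_stat n u m \<le> 1 - t" if "1 \<le> m" "m \<le> n" for m
    using order_stat_in[of n u "{t..1-t}" m] u that by auto
  have "spaced (1 / real n ^ 3) {1..n} u" using assms(1) by (simp add: good_sample_def)
  then have sp: "\<And>i. i < n \<Longrightarrow> 1 / real n ^ 3 \<le> order_stat n u (Suc i) - order_stat n u i"
    using spaced_iff_spacings[of "1 / real n ^ 3" n u] assms by auto
  have "order_stat n u (Suc i) \<le> order_stat n u j" using assms by (intro mono) auto
  moreover have "1 / real n ^ 3 > 0" using assms by simp
  ultimately show "0 < D" using sp[of i] assms unfolding D_def by linarith
  have i0: "0 \<le> order_stat n u i" using mono[of 0 i] assms by simp
  show "D < 1" using xm[of j] i0 assms t unfolding D_def by force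
  have dev: "\<bar>real n * order_stat n u m - real m\<bar> \<le> real n powr 0.7 + 1" if "m \<le> n" for m
    using that assms(1) by (intro order_stat_deviation assms u0) (auto simp: good_sample_def)
  \<comment> \<open>Each end of the window contributes \<open>n powr 0.7 + 1\<close>, and the 1 is
    absorbed.\<close>
  have "1 \<le> real n powr 0.7" using assms by (intro ge_one_powr_ge_zero) auto
  then show "\<bar>real (j - i) - real n * D\<bar> \<le> 4 * real n powr 0.7"
    using dev[of i] dev[of j] assms unfolding D_def
    by (simp add: of_nat_diff right_diff_distrib abs_le_iff)
  have xj: "order_stat n u j \<le> 1 - t" using xm[of j] assms(3,4) by simp
  then show "real n powr (-1.6) \<le> 1 - D"
    using i0 unfolding D_def t_def[symmetric] by linarith
  show "real (n - (j - i)) * real n powr (-1.27) / 32 \<le> 1 - D" if q: "10 \<le> n - (j - i)"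
  proof -
    have j1: "order_stat n u j \<le> order_stat n u n" "order_stat n u n \<le> 1 - t"
      using mono[of j n] xm[of n] assms by auto
    have q2: "n - (j - i) = i + (n - j)" using assms by auto
    show ?thesis
    proof (cases "n - j \<le> i")
      case True
      then have "5 \<le> i" using q q2 by linarith
      then have "real i * t' / 16 \<le> order_stat n u i"
        using good_sample_window(2)[OF assms(1,2), of 0 i] assms by (simp add: t'_def)
      moreover have "real (i + (n - j)) * t' \<le> (2 * real i) * t'"
        using True t by (intro mult_right_mono) auto
      moreover have "order_stat n u j \<le> 1" using j1 t by linarith
      ultimately show ?thesis unfolding q2 D_def t'_def[symmetric] by linarith
    next
      case False
      then have "5 \<le> n - j" using q q2 by linarith
      then have "real (n - j) * t' / 16 \<le> order_stat n u n - order_stat n u j"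
        using good_sample_window(2)[OF assms(1,2), of j n] by (simp add: t'_def)
      moreover have "real (i + (n - j)) * t' \<le> (2 * real (n - j)) * t'"
        using False t by (intro mult_right_mono) auto
      ultimately show ?thesis using j1 i0 t unfolding q2 D_def t'_def[symmetric] by linarith
    qed
  qed
qed

text \<open>The lower bound is the upper bound for the complementary pair, whose denominator is the
  same. It covers complements of a single step too, since \<open>1 - D\<close> is at least
  \<open>n powr (-1.6)\<close> for every window.\<close>

lemma good_sample_M_tilde_ij:
  assumes "\<epsilon> > 0"
  shows "\<forall>\<^sub>F n in sequentially. \<forall>u i j. good_sample n u \<longrightarrow> i < j \<longrightarrow> j \<le> n \<longrightarrow>
    (2 \<le> j - i \<longrightarrow> M_tilde_ij n u i j \<le> \<epsilon> * sqrt (real n)) \<and> - (\<epsilon> * sqrt (real n)) \<le> M_tilde_ij n u i j"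
  using ratio_bound_eventually[OF assms] eventually_ge_at_top[of "1::nat"]
proof eventually_elim
  case (elim n)
  show ?case
  proof (intro allI impI)
    fix u i j assume h: "good_sample n u" "i < j" "j \<le> n"
    define k where "k = j - i"
    define D where "D = order_stat n u j - order_stat n u i"
    note b = good_sample_bounds[OF h(1) elim(2) h(2,3), folded D_def k_def]
    note w = good_sample_window[OF h(1) elim(2) h(2,3), folded D_def k_def]
    have k: "k \<le> n" "real k = real j - real i" using h by (auto simp: k_def)
    have M: "M_tilde_ij n u i j = (real k - real n * D) / sqrt (real n * D * (1 - D))"
      using k by (simp add: M_tilde_ij_def D_def algebra_simps)
    have "M_tilde_ij n u i j \<le> \<epsilon> * sqrt (real n)" if "2 \<le> k"
    proof -
      have "real k * real n powr (-1.27) / 32 \<le> D" if "10 \<le> k"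
      proof -
        have "0 \<le> real k * real n powr (-1.27)" by simp
        moreover have "real k * real n powr (-1.27) / 16 \<le> D" using w(2) that by simp
        ultimately show ?thesis by linarith
      qed
      then show ?thesis unfolding M using elim(1)[rule_format, of k D] b(1-3) w(1) that k by auto
    qed
    moreover have "- (\<epsilon> * sqrt (real n)) \<le> M_tilde_ij n u i j"
    proof (cases "k = n")
      case True
      have "0 \<le> (real k - real n * D) / sqrt (real n * D * (1 - D))"
        using True b(1,2) by (intro divide_nonneg_nonneg) (auto simp: mult_left_le)
      moreover have "0 \<le> \<epsilon> * sqrt (real n)" using assms by simp
      ultimately show ?thesis unfolding M by linarith
    next
      case False
      have q: "real (n - k) - real n * (1 - D) = - (real k - real n * D)"
        using k by (simp add: of_nat_diff algebra_simps)
      have "(real (n - k) - real n * (1 - D)) / sqrt (real n * (1 - D) * (1 - (1 - D))) \<le> \<epsilon> * sqrt (real n)"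
      proof -
        have "n - k \<le> n" "0 < 1 - D" "1 - D < 1" using b by auto
        moreover have "\<bar>real (n - k) - real n * (1 - D)\<bar> \<le> 4 * real n powr 0.7"
          unfolding q using b(3) by simp
        ultimately show ?thesis using elim(1)[rule_format, of "n - k" "1 - D"] b(4,5) by auto
      qed
      moreover have "real n * (1 - D) * (1 - (1 - D)) = real n * D * (1 - D)" by simp
      ultimately show ?thesis unfolding M q by (simp only: minus_divide_left[symmetric] minus_le_iff)
    qed
    ultimately show "(2 \<le> j - i \<longrightarrow> M_tilde_ij n u i j \<le> \<epsilon> * sqrt (real n)) \<and> - (\<epsilon> * sqrt (real n)) \<le> M_tilde_ij n u i j"
      by (simp add: k_def)
  qed
qed

section \<open>The statistic of a single spacing\<close>

text \<open>If \<open>n D < 1\<close>, then \<open>(1 - n D)^2 \<le> 1 - n D \<le> 1 - D\<close>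
  cancels the factor \<open>1 - D\<close> under the root and leaves
  \<open>\<tau> \<le> n^2 D\<close>. Hence the bound holds for every \<open>n\<close>, without loss
  in \<open>\<tau>\<close>.\<close>

lemma adjacent_ratio_le:
  fixes D \<tau> :: real
  assumes "n \<ge> 1" "\<tau> > 0" "0 < D" "D < 1" "\<tau> / (real n)\<^sup>2 \<le> D"
  shows "(1 - real n * D) / sqrt (real n * D * (1 - D)) \<le> sqrt (real n / \<tau>)"
proof (cases "1 \<le> real n * D")
  case True
  have "(1 - real n * D) / sqrt (real n * D * (1 - D)) \<le> 0"
    using True assms by (intro divide_nonpos_nonneg) auto
  also have "0 \<le> sqrt (real n / \<tau>)" using assms by simp
  finally show ?thesis .
next
  case False
  have n: "real n \<ge> 1" using assms by simp
  have "D \<le> real n * D" using n assms by simp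
  have "(1 - real n * D)\<^sup>2 \<le> 1 - real n * D"
    using False assms n by (auto simp: power2_eq_square intro!: mult_left_le)
  also have "\<dots> \<le> 1 - D" using \<open>D \<le> real n * D\<close> by simp
  finally have s: "(1 - real n * D)\<^sup>2 \<le> 1 - D" .
  have "\<tau> \<le> real n * (real n * D)" using assms by (simp add: field_simps power2_eq_square)
  then have "1 \<le> real n * D * (real n / \<tau>)" using assms by (simp add: field_simps)
  then have "1 * (1 - D) \<le> real n * D * (real n / \<tau>) * (1 - D)" using assms by (intro mult_right_mono) auto
  then have "(1 - real n * D)\<^sup>2 \<le> real n / \<tau> * (real n * D * (1 - D))" using s by (simp add: mult_ac)
  then have "1 - real n * D \<le> sqrt (real n / \<tau> * (real n * D * (1 - D)))" by (rule real_le_rsqrt)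
  then show ?thesis using assms by (simp add: real_sqrt_mult[symmetric] pos_divide_le_eq)
qed

text \<open>After multiplication by the denominator, the left side is at most
  \<open>sqrt (\<sigma> / \<tau>) < 1\<close>, while the numerator exceeds
  \<open>1 - \<sigma> / n\<close>, which tends to 1. The slack \<open>\<sigma> < \<tau>\<close> pays
  for this correction.\<close>

lemma adjacent_ratio_gt_eventually:
  fixes \<sigma> \<tau> :: real
  assumes "0 < \<sigma>" "\<sigma> < \<tau>"
  shows "\<forall>\<^sub>F n in sequentially. \<forall>D. 0 < D \<and> D < \<sigma> / (real n)\<^sup>2 \<longrightarrow>
    sqrt (real n / \<tau>) < (1 - real n * D) / sqrt (real n * D * (1 - D))"
proof -
  have s: "\<sigma> / \<tau> < 1" using assms by simp
  have "\<forall>\<^sub>F n in sequentially. \<sigma> / real n < 1 - sqrt (\<sigma> / \<tau>)"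
  proof -
    have "sqrt (\<sigma> / \<tau>) < 1" using s by simp
    moreover have "(\<lambda>n. \<sigma> / real n) \<longlonglongrightarrow> 0" by real_asymp
    ultimately show ?thesis by (intro order_tendstoD(2)[of _ 0]) auto
  qed
  moreover have "\<forall>\<^sub>F n in sequentially. \<sigma> / (real n)\<^sup>2 < 1" using assms by real_asymp
  ultimately show ?thesis using eventually_ge_at_top[of "1::nat"]
  proof eventually_elim
    case (elim n)
    show ?case
    proof (intro allI impI, elim conjE)
      fix D assume D: "0 < D" "D < \<sigma> / (real n)\<^sup>2"
      have n: "real n > 0" using elim by simp
      have D1: "D < 1" using D elim by linarith
      have nD: "real n * D < \<sigma> / real n" using D n by (simp add: field_simps power2_eq_square)
      have "real n * D * (1 - D) < real n * D" using D D1 n by simp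
      then have "real n * D * (1 - D) \<le> \<sigma> / real n" using nD by linarith
      then have "real n / \<tau> * (real n * D * (1 - D)) \<le> real n / \<tau> * (\<sigma> / real n)"
        using assms by (intro mult_left_mono) auto
      also have "\<dots> = \<sigma> / \<tau>" using n by simp
      finally have "sqrt (real n / \<tau> * (real n * D * (1 - D))) \<le> sqrt (\<sigma> / \<tau>)" by simp
      also have "\<dots> < 1 - real n * D" using elim nD by linarith
      finally have "sqrt (real n / \<tau>) * sqrt (real n * D * (1 - D)) < 1 - real n * D"
        by (simp only: real_sqrt_mult)
      then show "sqrt (real n / \<tau>) < (1 - real n * D) / sqrt (real n * D * (1 - D))"
        using D D1 n by (simp add: pos_less_divide_eq)
    qed
  qed
qed

section \<open>Maximum and minimum over all pairs\<close>

lemma finite_index_pairs [simp]: "finite (index_pairs n)"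
  by (rule finite_subset[of _ "{..n} \<times> {..n}"]) (auto simp: index_pairs_def)

lemma mem_index_pairs: "(i, j) \<in> index_pairs n \<longleftrightarrow> i < j \<and> j \<le> n"
  by (auto simp: index_pairs_def)

lemma ball_index_pairs:
  "(\<forall>x\<in>index_pairs n. R x) \<longleftrightarrow> (\<forall>i j. i < j \<longrightarrow> j \<le> n \<longrightarrow> R (i, j))"
  by (auto simp add: Ball_def split_paired_All mem_index_pairs)

lemma index_pairs_nonempty: "n \<ge> 1 \<Longrightarrow> index_pairs n \<noteq> {}"
  using mem_index_pairs[of 0 1 n] by auto

lemma M_tilde_plus_le_iff:
  "n \<ge> 1 \<Longrightarrow> M_tilde_plus n u \<le> c \<longleftrightarrow> (\<forall>i j. i < j \<longrightarrow> j \<le> n \<longrightarrow> M_tilde_ij n u i j \<le> c)"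
  unfolding M_tilde_plus_def using index_pairs_nonempty[of n]
  by (subst Max_le_iff) (simp_all add: ball_index_pairs)

lemma M_tilde_minus_le_iff:
  "n \<ge> 1 \<Longrightarrow> M_tilde_minus n u \<le> c \<longleftrightarrow> (\<forall>i j. i < j \<longrightarrow> j \<le> n \<longrightarrow> - c \<le> M_tilde_ij n u i j)"
proof -
  assume n: "n \<ge> 1"
  have "M_tilde_minus n u \<le> c \<longleftrightarrow> - c \<le> Min ((\<lambda>(i, j). M_tilde_ij n u i j) ` index_pairs n)"
    unfolding M_tilde_minus_def by linarith
  also have "\<dots> \<longleftrightarrow> (\<forall>i j. i < j \<longrightarrow> j \<le> n \<longrightarrow> - c \<le> M_tilde_ij n u i j)"
    using index_pairs_nonempty[OF n] by (subst Min_ge_iff) (simp_all add: ball_index_pairs)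
  finally show ?thesis .
qed

lemma M_tilde_adjacent:
  "M_tilde_ij n u i (Suc i) = (let D = order_stat n u (Suc i) - order_stat n u i in
     (1 - real n * D) / sqrt (real n * D * (1 - D)))"
  by (simp add: M_tilde_ij_def Let_def algebra_simps)

text \<open>With \<open>\<epsilon> = 1 / sqrt \<tau>\<close> the bound for the negligible pairs is
  exactly the threshold, so only single spacings could exceed it.\<close>

lemma M_tilde_le_if_spaced:
  assumes "\<tau> > 0"
  shows "\<forall>\<^sub>F n in sequentially. \<forall>u. good_sample n u \<longrightarrow> spaced (\<tau> / (real n)\<^sup>2) {1..n} u \<longrightarrow>
    M_tilde n u \<le> sqrt (real n / \<tau>)"
proof -
  have \<epsilon>: "1 / sqrt \<tau> > 0" using assms by simp
  show ?thesis
    using good_sample_M_tilde_ij[OF \<epsilon>] eventually_ge_at_top[of "1::nat"]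
  proof eventually_elim
    case (elim n)
    have e: "1 / sqrt \<tau> * sqrt (real n) = sqrt (real n / \<tau>)" by (simp add: real_sqrt_divide)
    show ?case
    proof (intro allI impI)
      fix u assume g: "good_sample n u" and s: "spaced (\<tau> / (real n)\<^sup>2) {1..n} u"
      have "\<tau> / (real n)\<^sup>2 > 0" using assms elim by simp
      then have sp: "\<tau> / (real n)\<^sup>2 \<le> order_stat n u (Suc i) - order_stat n u i" if "i < n" for i
        using s spaced_iff_spacings that by blast
      have "M_tilde_ij n u i j \<le> sqrt (real n / \<tau>)" if ij: "i < j" "j \<le> n" for i j
      proof (cases "j = Suc i")
        case True
        then show ?thesis unfolding True M_tilde_adjacent Let_def
          using ij sp good_sample_bounds(1,2)[OF g elim(2), of i "Suc i"] assms elim(2)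
          by (intro adjacent_ratio_le) auto
      next
        case False
        then show ?thesis using ij elim(1) g e by (auto simp: Suc_le_eq)
      qed
      then have "M_tilde_plus n u \<le> sqrt (real n / \<tau>)" using elim(2) by (simp add: M_tilde_plus_le_iff)
      moreover have "M_tilde_minus n u \<le> sqrt (real n / \<tau>)" using elim g e by (simp add: M_tilde_minus_le_iff)
      ultimately show "M_tilde n u \<le> sqrt (real n / \<tau>)" by (simp add: M_tilde_def)
    qed
  qed
qed

text \<open>One short spacing lifts \<open>M_tilde_plus\<close> above the threshold while
  \<open>M_tilde_minus\<close> stays at or below it. Both limits rest on this event.\<close>

lemma M_tilde_gt_if_not_spaced:
  assumes "0 < \<sigma>" "\<sigma> < \<tau>"
  shows "\<forall>\<^sub>F n in sequentially. \<forall>u. good_sample n u \<longrightarrow> \<not> spaced (\<sigma> / (real n)\<^sup>2) {1..n} u \<longrightarrow>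
    M_tilde n u = M_tilde_plus n u \<and> sqrt (real n / \<tau>) < M_tilde n u"
proof -
  have \<epsilon>: "1 / sqrt \<tau> > 0" using assms by simp
  show ?thesis
    using good_sample_M_tilde_ij[OF \<epsilon>] adjacent_ratio_gt_eventually[OF assms] eventually_ge_at_top[of "1::nat"]
  proof eventually_elim
    case (elim n)
    have e: "1 / sqrt \<tau> * sqrt (real n) = sqrt (real n / \<tau>)" by (simp add: real_sqrt_divide)
    show ?case
    proof (intro allI impI)
      fix u assume g: "good_sample n u" and s: "\<not> spaced (\<sigma> / (real n)\<^sup>2) {1..n} u"
      have "\<sigma> / (real n)\<^sup>2 > 0" using assms elim by simp
      then obtain i where i: "i < n" "order_stat n u (Suc i) - order_stat n u i < \<sigma> / (real n)\<^sup>2"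
        using s spaced_iff_spacings not_le by blast
      then have "sqrt (real n / \<tau>) < M_tilde_ij n u i (Suc i)"
        unfolding M_tilde_adjacent Let_def
        using elim(2) good_sample_bounds(1)[OF g elim(3), of i "Suc i"] by auto
      moreover have "M_tilde_ij n u i (Suc i) \<le> M_tilde_plus n u"
        using M_tilde_plus_le_iff[of n u "M_tilde_plus n u"] elim(3) i(1) by auto
      moreover have "M_tilde_minus n u \<le> sqrt (real n / \<tau>)" using elim g e by (simp add: M_tilde_minus_le_iff)
      ultimately show "M_tilde n u = M_tilde_plus n u \<and> sqrt (real n / \<tau>) < M_tilde n u"
        by (simp add: M_tilde_def)
    qed
  qed
qed

subsection \<open>Spacings of a uniform sample\<close>

abbreviation (input) unif01 :: "real measure" where
  "unif01 \<equiv> uniform_measure lborel {0..1}"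

lemma prob_space_unif01: "prob_space unif01"
  by (rule prob_space_uniform_measure) auto

lemma measurable_PiM_unif01:
  "a \<in> I \<Longrightarrow> (\<lambda>u. u a) \<in> borel_measurable (Pi\<^sub>M I (\<lambda>_. unif01))"
  using measurable_component_singleton[of a I "\<lambda>_. unif01"]
  by (simp cong: measurable_cong_sets)

lemma spaced_measurable:
  assumes "finite I" "\<And>a. a \<in> I \<Longrightarrow> X a \<in> borel_measurable M"
  shows "{\<omega> \<in> space M. spaced s I (\<lambda>a. X a \<omega>)} \<in> sets M"
    and "{\<omega> \<in> space M. spaced s I (\<lambda>a. X a \<omega>) \<and> (\<forall>a\<in>I. X a \<omega> \<le> b)} \<in> sets M"
    and "m \<in> I \<Longrightarrow> {\<omega> \<in> space M. spaced s I (\<lambda>a. X a \<omega>) \<and> X m \<omega> \<le> b \<and>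
           (\<forall>a\<in>I. a \<noteq> m \<longrightarrow> X a \<omega> \<le> X m \<omega> - s)} \<in> sets M"
proof -
  note [measurable] = assms
  show "{\<omega> \<in> space M. spaced s I (\<lambda>a. X a \<omega>)} \<in> sets M"
    and "{\<omega> \<in> space M. spaced s I (\<lambda>a. X a \<omega>) \<and> (\<forall>a\<in>I. X a \<omega> \<le> b)} \<in> sets M"
    unfolding spaced_def by measurable
  show "m \<in> I \<Longrightarrow> {\<omega> \<in> space M. spaced s I (\<lambda>a. X a \<omega>) \<and> X m \<omega> \<le> b \<and>
           (\<forall>a\<in>I. a \<noteq> m \<longrightarrow> X a \<omega> \<le> X m \<omega> - s)} \<in> sets M"
    unfolding spaced_def by measurable
qed

lemma nn_integral_shifted_power:
  assumes "k \<ge> 1" "c \<le> b"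
  shows "(\<integral>\<^sup>+y. ennreal ((y - c) ^ (k - 1)) * indicator {c..b} y \<partial>lborel) = ennreal ((b - c) ^ k / k)"
proof -
  have "(\<integral>\<^sup>+y. ennreal ((y - c) ^ (k - 1)) * indicator {c..b} y \<partial>lborel) =
      ennreal ((b - c) ^ k / k - (c - c) ^ k / k)"
    by (rule nn_integral_FTC_Icc) (use assms in \<open>auto intro!: derivative_eq_intros\<close>)
  then show ?thesis using assms by (simp add: zero_power)
qed

text \<open>Split according to which coordinate is the largest: removing it, at height \<open>y\<close>, leaves a
  spaced configuration of the remaining coordinates below \<open>y - s\<close>.\<close>

lemma emeasure_spaced_below:
  assumes "finite I" "s > 0" "0 \<le> b" "b \<le> 1"
  shows "emeasure (Pi\<^sub>M I (\<lambda>_. unif01)) {u \<in> space (Pi\<^sub>M I (\<lambda>_. unif01)). spaced s I u \<and> (\<forall>a\<in>I. u a \<le> b)}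
    = ennreal (max 0 (b - real (card I) * s) ^ card I)"
  using assms
\<comment> \<open>\<open>b\<close> is generalized because the remaining coordinates are bounded by
  the varying \<open>y - s\<close>.\<close>
proof (induction "card I" arbitrary: I b)
  case 0
  interpret product_prob_space "\<lambda>_. unif01" I
    by (intro product_prob_spaceI prob_space_unif01)
  from 0 have "I = {}" by simp
  then show ?case using emeasure_space_1 by (simp add: spaced_def)
next
  case (Suc k)
  interpret product_prob_space "\<lambda>_. unif01" I
    by (intro product_prob_spaceI prob_space_unif01)
  note [simp] = \<open>finite I\<close>
  let ?P = "\<lambda>I. Pi\<^sub>M I (\<lambda>_::'a. unif01)"
  define T where "T m = {u \<in> space (?P I). spaced s I u \<and> u m \<le> b \<and> (\<forall>a\<in>I-{m}. u a \<le> u m - s)}" for m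
  define c where "c = real (Suc k) * s"
  have "s > 0" by fact
  have Tsets: "T m \<in> sets (?P I)" if "m \<in> I" for m
  proof -
    have "T m = {u \<in> space (?P I). spaced s I u \<and> u m \<le> b \<and> (\<forall>a\<in>I. a \<noteq> m \<longrightarrow> u a \<le> u m - s)}"
      by (auto simp: T_def)
    also have "\<dots> \<in> sets (?P I)"
      using that by (intro spaced_measurable(3) measurable_PiM_unif01) auto
    finally show ?thesis .
  qed
  have split: "{u \<in> space (?P I). spaced s I u \<and> (\<forall>a\<in>I. u a \<le> b)} = (\<Union>m\<in>I. T m)" (is "?L = ?R")
  proof (intro subset_antisym subsetI)
    fix u assume u: "u \<in> ?L"
    have ne: "I \<noteq> {}" using Suc by auto
    obtain m where m: "m \<in> I" "\<And>a. a \<in> I \<Longrightarrow> u a \<le> u m"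
    proof -
      have "Max (u ` I) \<in> u ` I" using ne by (intro Max_in) auto
      then obtain m where "m \<in> I" "Max (u ` I) = u m" by auto
      then show ?thesis using that by (metis Max_ge \<open>finite I\<close> finite_imageI imageI)
    qed
    have "u a \<le> u m - s" if "a \<in> I - {m}" for a
    proof -
      have "s \<le> \<bar>u a - u m\<bar>" using u that m(1) by (auto simp: spaced_def)
      then show ?thesis using m(2)[of a] that by auto
    qed
    then show "u \<in> ?R" using u m by (auto simp: T_def)
  next
    fix u assume "u \<in> ?R"
    then obtain m where m: "m \<in> I" "u \<in> T m" by auto
    have "u a \<le> b" if "a \<in> I" for a
      using m that \<open>s > 0\<close> by (cases "a = m") (force simp: T_def)+
    then show "u \<in> ?L" using m by (auto simp: T_def)
  qed
  have disj: "disjoint_family_on T I"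
    unfolding disjoint_family_on_def
  proof (intro ballI impI)
    fix l m assume lm: "l \<in> I" "m \<in> I" "l \<noteq> m"
    have False if "u \<in> T l" "u \<in> T m" for u
    proof -
      have "u l \<le> u m - s" "u m \<le> u l - s" using lm that by (auto simp: T_def)
      then show False using \<open>s > 0\<close> by linarith
    qed
    then show "T l \<inter> T m = {}" by blast
  qed
  have Tm: "emeasure (?P I) (T m) = ennreal (max 0 (b - c) ^ Suc k / Suc k)" if m: "m \<in> I" for m
  proof -
    define J where "J = I - {m}"
    have J: "finite J" "m \<notin> J" "I = insert m J" "k = card J" using m Suc by (auto simp: J_def)
    \<comment> \<open>\<open>s \<le> y\<close> is the clause of \<open>spaced\<close> for the
      largest coordinate; its distances to the others follow from
      \<open>x a \<le> y - s\<close>.\<close>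
    have ind: "indicator (T m) (x(m := y)) = (indicator {s..b} y *
       indicator {u \<in> space (?P J). spaced s J u \<and> (\<forall>a\<in>J. u a \<le> y - s)} x :: ennreal)"
      if "x \<in> space (?P J)" for x y
    proof -
      have "x(m := y) \<in> space (?P I)" using that J by (auto simp: space_PiM PiE_def extensional_def)
      have *: "(x(m := y)) a = x a" if "a \<in> J" for a using that J by auto
      have "x(m := y) \<in> T m \<longleftrightarrow> y \<in> {s..b} \<and> spaced s J x \<and> (\<forall>a\<in>J. x a \<le> y - s)"
      proof -
        have "spaced s I (x(m := y)) \<longleftrightarrow> s \<le> y \<and> spaced s J x" if "\<forall>a\<in>J. x a \<le> y - s"
        proof -
          have "s \<le> \<bar>x a - y\<bar>" "s \<le> \<bar>y - x a\<bar>" if "a \<in> J" for a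
            using \<open>\<forall>a\<in>J. x a \<le> y - s\<close> that \<open>s > 0\<close> by force+
          moreover have "a \<noteq> m" if "a \<in> J" for a using that J by auto
          ultimately show ?thesis unfolding spaced_def J(3) by auto
        qed
        moreover have "(\<forall>a\<in>I - {m}. (x(m := y)) a \<le> (x(m := y)) m - s) \<longleftrightarrow> (\<forall>a\<in>J. x a \<le> y - s)"
          unfolding J_def by auto
        ultimately show ?thesis using \<open>x(m := y) \<in> space (?P I)\<close> unfolding T_def by auto
      qed
      then show ?thesis using that by (auto simp: indicator_def)
    qed
    have meas: "{u \<in> space (?P J). spaced s J u \<and> (\<forall>a\<in>J. u a \<le> y - s)} \<in> sets (?P J)" for y
      by (intro spaced_measurable(2) measurable_PiM_unif01 J)
    have "emeasure (?P I) (T m) = (\<integral>\<^sup>+u. indicator (T m) u \<partial>?P (insert m J))"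
      using Tsets[OF m] J(3) by simp
    also have "\<dots> = (\<integral>\<^sup>+y. (\<integral>\<^sup>+x. indicator (T m) (x(m := y)) \<partial>?P J) \<partial>unif01)"
      using J Tsets[OF m] by (intro product_nn_integral_insert_rev) auto
    also have "\<dots> = (\<integral>\<^sup>+y. indicator {s..b} y *
        emeasure (?P J) {u \<in> space (?P J). spaced s J u \<and> (\<forall>a\<in>J. u a \<le> y - s)} \<partial>unif01)"
      using meas by (intro nn_integral_cong) (simp add: ind nn_integral_cmult cong: nn_integral_cong)
    also have "\<dots> = (\<integral>\<^sup>+y. ennreal ((y - c) ^ (Suc k - 1)) * indicator {c..b} y \<partial>unif01)"
    proof (intro nn_integral_cong)
      fix y
      show "indicator {s..b} y *
          emeasure (?P J) {u \<in> space (?P J). spaced s J u \<and> (\<forall>a\<in>J. u a \<le> y - s)} =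
        ennreal ((y - c) ^ (Suc k - 1)) * indicator {c..b} y"
      proof (cases "y \<in> {s..b}")
        case True
        have "emeasure (?P J) {u \<in> space (?P J). spaced s J u \<and> (\<forall>a\<in>J. u a \<le> y - s)}
            = ennreal (max 0 (y - s - real (card J) * s) ^ card J)"
          using True Suc.prems by (intro Suc.hyps(1)[OF J(4,1)]) auto
        moreover have "y - s - real (card J) * s = y - c" using J by (simp add: c_def algebra_simps)
        \<comment> \<open>For \<open>k = 0\<close> the power is 1 whatever its base; then
          \<open>c = s\<close>, so the indicator is 1 as well.\<close>
        moreover have "ennreal (max 0 (y - c) ^ k) = ennreal ((y - c) ^ k) * indicator {c..b} y"
          using True by (cases "c \<le> y"; cases "k = 0") (auto simp: c_def max_def indicator_def)
        ultimately show ?thesis using True J(4) by simp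
      next
        case False
        have "s \<le> c" using \<open>s > 0\<close> by (simp add: c_def)
        then show ?thesis using False by (auto simp: indicator_def)
      qed
    qed
    also have "\<dots> = (\<integral>\<^sup>+y. ennreal ((y - c) ^ (Suc k - 1)) * indicator {c..b} y * indicator {0..1} y \<partial>lborel)"
      by (subst nn_integral_uniform_measure) (auto simp: divide_ennreal_def)
    also have "\<dots> = (\<integral>\<^sup>+y. ennreal ((y - c) ^ (Suc k - 1)) * indicator {c..b} y \<partial>lborel)"
    proof (intro nn_integral_cong)
      fix y :: real
      have "0 \<le> c" using \<open>s > 0\<close> by (simp add: c_def)
      then show "ennreal ((y - c) ^ (Suc k - 1)) * indicator {c..b} y * indicator {0..1} y =
        ennreal ((y - c) ^ (Suc k - 1)) * indicator {c..b} y"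
        using \<open>b \<le> 1\<close> by (auto simp: indicator_def)
    qed
    also have "\<dots> = ennreal (max 0 (b - c) ^ Suc k / Suc k)"
    proof (cases "c \<le> b")
      case True
      then show ?thesis using nn_integral_shifted_power[of "Suc k" c b] by (simp add: max_def)
    next
      case False
      then show ?thesis by simp
    qed
    finally show ?thesis .
  qed
  have "emeasure (?P I) {u \<in> space (?P I). spaced s I u \<and> (\<forall>a\<in>I. u a \<le> b)} = (\<Sum>m\<in>I. emeasure (?P I) (T m))"
    unfolding split using Tsets disj by (intro sum_emeasure[symmetric]) auto
  also have "\<dots> = (\<Sum>m\<in>I. ennreal (max 0 (b - c) ^ Suc k / Suc k))"
    by (intro sum.cong Tm) auto
  \<comment> \<open>The \<open>k + 1\<close> choices of the largest coordinate cancel the factor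
    \<open>1 / (k + 1)\<close> from the integral.\<close>
  also have "\<dots> = ennreal (real (Suc k) * (max 0 (b - c) ^ Suc k / Suc k))"
    unfolding sum_constant Suc.hyps(2)[symmetric]
    by (subst ennreal_mult) (auto simp: ennreal_of_nat_eq_real_of_nat)
  also have "real (Suc k) * (max 0 (b - c) ^ Suc k / Suc k) = max 0 (b - c) ^ Suc k" by simp
  finally show ?case unfolding Suc.hyps(2)[symmetric] c_def .
qed

section \<open>Probability bounds for one sample\<close>

locale uniform_sample = prob_space M for M :: "'a measure" +
  fixes I :: "'b set" and X :: "'b \<Rightarrow> 'a \<Rightarrow> real"
  assumes finite_I [simp]: "finite I" and I_nonempty: "I \<noteq> {}"
    and indep: "indep_vars (\<lambda>_. borel) X I"
    and uniform: "i \<in> I \<Longrightarrow> distr M borel (X i) = unif01"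
begin

lemma random_variable_X [measurable]: "i \<in> I \<Longrightarrow> X i \<in> borel_measurable M"
  using indep unfolding indep_vars_def by blast

lemma prob_X_in:
  assumes "i \<in> I" "A \<in> sets borel"
  shows "prob {\<omega>\<in>space M. X i \<omega> \<in> A} = measure lborel ({0..1} \<inter> A)"
proof -
  have "prob {\<omega>\<in>space M. X i \<omega> \<in> A} = measure (distr M borel (X i)) A"
    using assms by (subst measure_distr) (auto intro!: arg_cong[where f = "measure M"])
  also have "\<dots> = measure lborel ({0..1} \<inter> A)"
    unfolding uniform[OF assms(1)] using assms(2) by (subst measure_uniform_measure) auto
  finally show ?thesis .
qed

lemma prob_X_Icc:
  assumes "i \<in> I" "a \<le> b"
  shows "prob {\<omega>\<in>space M. X i \<omega> \<in> {a..b}} \<le> b - a"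
proof -
  have "measure lborel ({0..1} \<inter> {a..b}) \<le> measure lborel {a..b}"
    by (intro measure_mono_fmeasurable) (auto intro!: fmeasurableI simp: emeasure_lborel_Icc_eq)
  then show ?thesis using prob_X_in[OF assms(1), of "{a..b}"] assms(2) by simp
qed

lemma AE_X: "AE \<omega> in M. \<forall>i\<in>I. X i \<omega> \<in> {0..1}"
proof -
  have "AE \<omega> in M. X i \<omega> \<in> {0..1}" if "i \<in> I" for i
    using prob_X_in[OF that, of "{0..1}"] that
    by (subst prob_Collect_eq_1[symmetric]) auto
  then show ?thesis by (simp add: AE_finite_all)
qed

lemma prob_X_window:
  assumes "B \<subseteq> I" "B \<noteq> {}" "a \<le> b"
  shows "prob {\<omega>\<in>space M. \<forall>i\<in>B. X i \<omega> \<in> {a..b}} \<le> (b - a) ^ card B"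
proof -
  have fB: "finite B" using assms(1) finite_I finite_subset by blast
  have "{\<omega>\<in>space M. \<forall>i\<in>B. X i \<omega> \<in> {a..b}} = (\<Inter>i\<in>B. X i -` {a..b} \<inter> space M)"
    using assms(2) by auto
  also have "prob \<dots> = (\<Prod>i\<in>B. prob (X i -` {a..b} \<inter> space M))"
    by (rule indep_varsD[OF indep assms(2) fB assms(1)]) auto
  also have "\<dots> = (\<Prod>i\<in>B. prob {\<omega>\<in>space M. X i \<omega> \<in> {a..b}})"
    by (intro prod.cong arg_cong[where f = prob]) auto
  also have "\<dots> \<le> (\<Prod>i\<in>B. b - a)"
    using assms by (intro prod_mono conjI prob_X_Icc measure_nonneg) auto
  finally show ?thesis by simp
qed

lemma cluster_measurable [measurable]: "{\<omega>\<in>space M. cluster r t I (\<lambda>i. X i \<omega>)} \<in> events"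
proof -
  have fin: "finite {B. B \<subseteq> I \<and> card B = r}" by simp
  have *: "{\<omega>\<in>space M. \<forall>a\<in>B. \<forall>b\<in>B. \<bar>X a \<omega> - X b \<omega>\<bar> < t} \<in> events" if "B \<subseteq> I" for B
  proof -
    have [measurable]: "finite B" using that finite_I finite_subset by blast
    have [measurable]: "X a \<in> borel_measurable M" if "a \<in> B" for a using that \<open>B \<subseteq> I\<close> by auto
    show ?thesis by measurable
  qed
  have "{\<omega>\<in>space M. cluster r t I (\<lambda>i. X i \<omega>)} =
      (\<Union>B\<in>{B. B \<subseteq> I \<and> card B = r}. {\<omega>\<in>space M. \<forall>a\<in>B. \<forall>b\<in>B. \<bar>X a \<omega> - X b \<omega>\<bar> < t})"
    by (auto simp: cluster_def)
  also have "\<dots> \<in> events" using * by (intro sets.finite_UN[OF fin]) auto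
  finally show ?thesis .
qed

text \<open>A cluster of diameter less than \<open>t\<close> lies in one of the windows \<open>[m t, (m + 2) t]\<close>.\<close>

lemma prob_cluster_le:
  assumes t: "t > 0" and r: "r \<ge> 1"
  shows "prob {\<omega>\<in>space M. cluster r t I (\<lambda>i. X i \<omega>)} \<le> (1 / t + 1) * (real (card I) ^ r * (2 * t) ^ r)"
proof -
  define W where "W m B = {\<omega>\<in>space M. \<forall>i\<in>B. X i \<omega> \<in> {real m * t..(real m + 2) * t}}" for m :: nat and B
  define Bs where "Bs = {B. B \<subseteq> I \<and> card B = r}"
  define N where "N = nat \<lfloor>1 / t\<rfloor>"
  have fin: "finite Bs" by (simp add: Bs_def)
  have finB: "finite B" "B \<noteq> {}" "B \<subseteq> I" "card B = r" if "B \<in> Bs" for B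
    using that r rev_finite_subset[OF finite_I] unfolding Bs_def by auto
  have W: "W m B \<in> events" if "B \<in> Bs" for m B
  proof -
    have [measurable]: "finite B" using finB(1)[OF that] .
    have [measurable]: "X a \<in> borel_measurable M" if "a \<in> B" for a
      using that finB(3)[OF \<open>B \<in> Bs\<close>] by auto
    show ?thesis unfolding W_def by measurable
  qed
  have "prob {\<omega>\<in>space M. cluster r t I (\<lambda>i. X i \<omega>)} \<le> prob (\<Union>(m, B)\<in>{..N} \<times> Bs. W m B)"
  proof (rule finite_measure_mono_AE)
    show "AE \<omega> in M. \<omega> \<in> {\<omega>\<in>space M. cluster r t I (\<lambda>i. X i \<omega>)} \<longrightarrow> \<omega> \<in> (\<Union>(m, B)\<in>{..N} \<times> Bs. W m B)"
      using AE_X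
    proof eventually_elim
      case (elim \<omega>)
      show ?case
      proof
        assume h: "\<omega> \<in> {\<omega>\<in>space M. cluster r t I (\<lambda>i. X i \<omega>)}"
        then obtain B where B: "B \<in> Bs" "\<And>a b. a \<in> B \<Longrightarrow> b \<in> B \<Longrightarrow> \<bar>X a \<omega> - X b \<omega>\<bar> < t"
          by (auto simp: cluster_def Bs_def)
        note fB = finB[OF B(1)]
        obtain a where a: "a \<in> B" "\<And>b. b \<in> B \<Longrightarrow> X a \<omega> \<le> X b \<omega>"
        proof -
          have "Min ((\<lambda>i. X i \<omega>) ` B) \<in> (\<lambda>i. X i \<omega>) ` B" using fB by (intro Min_in) auto
          then obtain a where "a \<in> B" "Min ((\<lambda>i. X i \<omega>) ` B) = X a \<omega>" by auto
          then show ?thesis using that fB by (metis Min_le finite_imageI imageI)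
        qed
        \<comment> \<open>The block of the leftmost point; the other points lie less than
          \<open>t\<close> to its right, hence below \<open>(m + 2) * t\<close>.\<close>
        define m where "m = nat \<lfloor>X a \<omega> / t\<rfloor>"
        have X: "0 \<le> X a \<omega>" "X a \<omega> \<le> 1" using elim a fB by auto
        have q: "0 \<le> X a \<omega> / t" "X a \<omega> / t \<le> 1 / t" using X t by (auto intro: divide_right_mono)
        then have m: "real m \<le> X a \<omega> / t" "X a \<omega> / t < real m + 1" unfolding m_def by linarith+
        have "m \<le> N" unfolding m_def N_def using q by (intro nat_mono floor_mono)
        moreover have "X i \<omega> \<in> {real m * t..(real m + 2) * t}" if "i \<in> B" for i
        proof -
          have "real m * t \<le> X a \<omega>" "X a \<omega> < (real m + 1) * t" using m t by (simp_all add: field_simps)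
          then show ?thesis using a(2)[OF that] B(2)[OF a(1) that] by (auto simp: algebra_simps)
        qed
        ultimately show "\<omega> \<in> (\<Union>(m, B)\<in>{..N} \<times> Bs. W m B)"
          using h B(1) by (auto simp: W_def)
      qed
    qed
    show "(\<Union>(m, B)\<in>{..N} \<times> Bs. W m B) \<in> events"
      using W fin by (intro sets.finite_UN) auto
  qed
  also have "\<dots> \<le> (\<Sum>(m, B)\<in>{..N} \<times> Bs. prob (W m B))"
    using finite_measure_subadditive_finite[of "{..N} \<times> Bs" "\<lambda>(m, B). W m B"] W fin
    by (auto simp: case_prod_beta image_subset_iff)
  also have "\<dots> \<le> (\<Sum>(m, B)\<in>{..N} \<times> Bs. (2 * t) ^ r)"
  proof (intro sum_mono, clarify)
    fix m B assume "B \<in> Bs"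
    then show "prob (W m B) \<le> (2 * t) ^ r"
      using prob_X_window[of B "real m * t" "(real m + 2) * t"] finB[of B] t unfolding W_def
      by (auto simp: algebra_simps)
  qed
  also have "\<dots> = (real N + 1) * (real (card Bs) * (2 * t) ^ r)"
    by (simp add: case_prod_beta card_cartesian_product algebra_simps)
  also have "\<dots> \<le> (1 / t + 1) * (real (card I) ^ r * (2 * t) ^ r)"
  proof (intro mult_mono)
    show "real N + 1 \<le> 1 / t + 1" using t by (simp add: N_def)
    have "card Bs = card I choose r" unfolding Bs_def by (rule n_subsets) simp
    also have "\<dots> \<le> card I ^ r" by (cases "r \<le> card I") (auto intro: binomial_le_pow simp: binomial_eq_0)
    finally show "real (card Bs) \<le> real (card I) ^ r" by (metis of_nat_le_iff of_nat_power)
  qed (use t in auto)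
  finally show ?thesis .
qed

lemma prob_near_boundary_le:
  assumes "t \<ge> 0"
  shows "prob {\<omega>\<in>space M. \<exists>i\<in>I. \<not> (t \<le> X i \<omega> \<and> X i \<omega> \<le> 1 - t)} \<le> real (card I) * (2 * t)"
proof -
  define E where "E i = {\<omega>\<in>space M. X i \<omega> \<in> {0..t}} \<union> {\<omega>\<in>space M. X i \<omega> \<in> {1 - t..1}}" for i
  have E: "E i \<in> events" if "i \<in> I" for i
    using random_variable_X[OF that] unfolding E_def by measurable
  have "prob {\<omega>\<in>space M. \<exists>i\<in>I. \<not> (t \<le> X i \<omega> \<and> X i \<omega> \<le> 1 - t)} \<le> prob (\<Union>i\<in>I. E i)"
  proof (rule finite_measure_mono_AE)
    show "AE \<omega> in M. \<omega> \<in> {\<omega>\<in>space M. \<exists>i\<in>I. \<not> (t \<le> X i \<omega> \<and> X i \<omega> \<le> 1 - t)} \<longrightarrow> \<omega> \<in> (\<Union>i\<in>I. E i)"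
      using AE_X by eventually_elim (fastforce simp: E_def)
  qed (use E in auto)
  also have "\<dots> \<le> (\<Sum>i\<in>I. prob (E i))"
    using E by (intro finite_measure_subadditive_finite) auto
  also have "\<dots> \<le> (\<Sum>i\<in>I. 2 * t)"
  proof (intro sum_mono)
    fix i assume i: "i \<in> I"
    have [measurable]: "X i \<in> borel_measurable M" using i by auto
    have "prob (E i) \<le> prob {\<omega>\<in>space M. X i \<omega> \<in> {0..t}} + prob {\<omega>\<in>space M. X i \<omega> \<in> {1 - t..1}}"
      unfolding E_def by (intro measure_Un_le) measurable
    also have "\<dots> \<le> (t - 0) + (1 - (1 - t))"
      using i assms by (intro add_mono prob_X_Icc) auto
    finally show "prob (E i) \<le> 2 * t" by simp
  qed
  finally show ?thesis by simp
qed

text \<open>Hoeffding's inequality for the indicators of \<open>X i \<le> y\<close>, which have mean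
  \<open>y\<close>.\<close>

lemma prob_empirical_deviation_le:
  assumes "0 \<le> y" "y \<le> 1" "c \<ge> 0"
  shows "prob {\<omega>\<in>space M. c \<le> \<bar>real (card {i\<in>I. X i \<omega> \<le> y}) - real (card I) * y\<bar>}
    \<le> 2 * exp (-2 * c\<^sup>2 / real (card I))"
proof -
  define Y where "Y i \<omega> = (indicator {..y} (X i \<omega>) :: real)" for i \<omega>
  have card: "card I > 0" using I_nonempty by (simp add: card_gt_0_iff)
  have "indep_vars (\<lambda>_. borel) Y I"
    unfolding Y_def by (rule indep_vars_compose2[OF indep]) measurable
  moreover have "expectation (Y i) = y" if "i \<in> I" for i
  proof -
    have [measurable]: "X i \<in> borel_measurable M" using that by auto
    have "expectation (Y i) = expectation (indicator {\<omega>\<in>space M. X i \<omega> \<in> {..y}})"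
      by (intro Bochner_Integration.integral_cong) (auto simp: Y_def indicator_def)
    also have "\<dots> = prob {\<omega>\<in>space M. X i \<omega> \<in> {..y}}" by (simp add: Bochner_Integration.integral_indicator Int_def conj_commute)
    also have "\<dots> = measure lborel ({0..1} \<inter> {..y})" using that by (rule prob_X_in) simp
    also have "{0..1} \<inter> {..y} = {0..y}" using assms by auto
    finally show ?thesis using assms by simp
  qed
  then have e: "(\<Sum>i\<in>I. expectation (Y i)) = real (card I) * y" by simp
  interpret H: Hoeffding_ineq M I Y "\<lambda>_. 0" "\<lambda>_. 1" "\<Sum>i\<in>I. expectation (Y i)"
    by unfold_locales (use \<open>indep_vars (\<lambda>_. borel) Y I\<close> in \<open>auto simp: Y_def indicator_def\<close>)
  have "(\<Sum>i\<in>I. Y i \<omega>) = real (card {i\<in>I. X i \<omega> \<le> y})" for \<omega>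
    by (simp add: Y_def indicator_def sum.If_cases Int_def)
  then show ?thesis using H.Hoeffding_ineq_abs_ge[OF assms(3)] card e by simp
qed

lemma spaced_event [measurable]: "{\<omega>\<in>space M. spaced s I (\<lambda>i. X i \<omega>)} \<in> events"
  by (intro spaced_measurable) auto

text \<open>By independence the joint law is the product of uniform laws, so the product formula
  applies with \<open>b = 1\<close>; the bound \<open>u a \<le> 1\<close> holds almost
  surely.\<close>

lemma prob_spaced:
  assumes "s > 0"
  shows "prob {\<omega>\<in>space M. spaced s I (\<lambda>i. X i \<omega>)} = max 0 (1 - real (card I) * s) ^ card I"
proof -
  let ?\<Pi> = "Pi\<^sub>M I (\<lambda>_. unif01)"
  let ?S = "{u \<in> space ?\<Pi>. spaced s I u \<and> (\<forall>a\<in>I. u a \<le> 1)}"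
  let ?X = "\<lambda>\<omega>. \<lambda>i\<in>I. X i \<omega>"
  have sets: "sets ?\<Pi> = sets (Pi\<^sub>M I (\<lambda>_. borel))" by (intro sets_PiM_cong) auto
  have X: "?X \<in> measurable M (Pi\<^sub>M I (\<lambda>_. borel))"
    by (intro measurable_restrict) auto
  have "distr M (Pi\<^sub>M I (\<lambda>_. borel)) ?X = Pi\<^sub>M I (\<lambda>i. distr M borel (X i))"
    using indep_vars_iff_distr_eq_PiM'[OF I_nonempty, where M' = "\<lambda>_. borel" and X = X] indep by auto
  also have "\<dots> = ?\<Pi>" by (intro PiM_cong) (auto simp: uniform)
  finally have d: "distr M (Pi\<^sub>M I (\<lambda>_. borel)) ?X = ?\<Pi>" .
  have S: "?S \<in> sets ?\<Pi>" by (intro spaced_measurable(2) measurable_PiM_unif01) auto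
  have "prob {\<omega>\<in>space M. spaced s I (\<lambda>i. X i \<omega>)} = prob (?X -` ?S \<inter> space M)"
  proof (rule finite_measure_eq_AE)
    show "AE \<omega> in M. \<omega> \<in> {\<omega>\<in>space M. spaced s I (\<lambda>i. X i \<omega>)} \<longleftrightarrow> \<omega> \<in> ?X -` ?S \<inter> space M"
      using AE_X
    proof eventually_elim
      case (elim \<omega>)
      then show ?case by (auto simp: spaced_def space_PiM)
    qed
    show "?X -` ?S \<inter> space M \<in> events" by (rule measurable_sets[OF X]) (use S sets in simp)
  qed measurable
  also have "\<dots> = measure (distr M (Pi\<^sub>M I (\<lambda>_. borel)) ?X) ?S"
    using S X sets by (intro measure_distr[symmetric]) auto
  also have "\<dots> = measure ?\<Pi> ?S" by (simp only: d)
  also have "\<dots> = max 0 (1 - real (card I) * s) ^ card I"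
    using emeasure_spaced_below[OF finite_I assms, of 1] by (simp add: measure_def)
  finally show ?thesis .
qed

end

context uniform_sample
begin

lemma empirical_count_measurable [measurable]:
  "(\<lambda>\<omega>. real (card {i\<in>I. X i \<omega> \<le> y})) \<in> borel_measurable M"
proof -
  have "(\<lambda>\<omega>. \<Sum>i\<in>I. indicator {..y} (X i \<omega>) :: real) \<in> borel_measurable M"
    by (intro borel_measurable_sum borel_measurable_indicator') auto
  also have "(\<lambda>\<omega>. \<Sum>i\<in>I. indicator {..y} (X i \<omega>)) = (\<lambda>\<omega>. real (card {i\<in>I. X i \<omega> \<le> y}))"
    by (simp add: indicator_def sum.If_cases Int_def)
  finally show ?thesis .
qed

end

section \<open>Measurability and the exceptional event\<close>

locale ordered_uniform_sample = uniform_sample M "{1..n}" X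
  for M :: "'a measure" and n :: nat and X
begin

lemma n_ge_1: "n \<ge> 1"
  using I_nonempty by auto

lemma order_stat_measurable [measurable]:
  assumes "k \<le> n"
  shows "(\<lambda>\<omega>. order_stat n (\<lambda>i. X i \<omega>) k) \<in> borel_measurable M"
proof (cases "k = 0")
  case False
  have "{\<omega>\<in>space M. real k \<le> real (card {i\<in>{1..n}. X i \<omega> \<le> y})} \<in> events" for y
    by measurable
  then show ?thesis
    using False assms by (simp add: borel_measurable_iff_le order_stat_le_iff)
qed simp

lemma M_tilde_ij_measurable [measurable]:
  assumes "i \<le> n" "j \<le> n"
  shows "(\<lambda>\<omega>. M_tilde_ij n (\<lambda>i. X i \<omega>) i j) \<in> borel_measurable M"
proof -
  note [measurable] = order_stat_measurable[OF assms(1)] order_stat_measurable[OF assms(2)]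
  show ?thesis unfolding M_tilde_ij_def by measurable
qed

lemma M_tilde_plus_measurable [measurable]:
    "(\<lambda>\<omega>. M_tilde_plus n (\<lambda>i. X i \<omega>)) \<in> borel_measurable M"
  and M_tilde_minus_measurable [measurable]:
    "(\<lambda>\<omega>. M_tilde_minus n (\<lambda>i. X i \<omega>)) \<in> borel_measurable M"
proof -
  have *: "(\<lambda>\<omega>. case p of (i, j) \<Rightarrow> M_tilde_ij n (\<lambda>i. X i \<omega>) i j) \<in> borel_measurable M"
    if "p \<in> index_pairs n" for p
    using that by (cases p) (auto simp: mem_index_pairs intro!: M_tilde_ij_measurable)
  show "(\<lambda>\<omega>. M_tilde_plus n (\<lambda>i. X i \<omega>)) \<in> borel_measurable M"
    unfolding M_tilde_plus_def by (rule borel_measurable_Max[OF finite_index_pairs *])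
  have "(\<lambda>\<omega>. Min ((\<lambda>(i, j). M_tilde_ij n (\<lambda>i. X i \<omega>) i j) ` index_pairs n)) \<in> borel_measurable M"
    by (rule borel_measurable_Min[OF finite_index_pairs *])
  then show "(\<lambda>\<omega>. M_tilde_minus n (\<lambda>i. X i \<omega>)) \<in> borel_measurable M"
    unfolding M_tilde_minus_def by measurable
qed

lemma M_tilde_measurable [measurable]:
  "(\<lambda>\<omega>. M_tilde n (\<lambda>i. X i \<omega>)) \<in> borel_measurable M"
  unfolding M_tilde_def by measurable

text \<open>A measurable set outside which the sample is good. The deviations are written in the
  form bounded by Hoeffding's inequality.\<close>

definition bad :: "'a set" where
  "bad = {\<omega>\<in>space M. \<exists>i\<in>{1..n}. \<not> (real n powr (-1.6) \<le> X i \<omega> \<and> X i \<omega> \<le> 1 - real n powr (-1.6))} \<union>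
    {\<omega>\<in>space M. cluster 3 (real n powr (-1.6)) {1..n} (\<lambda>i. X i \<omega>)} \<union>
    {\<omega>\<in>space M. cluster 5 (real n powr (-1.27)) {1..n} (\<lambda>i. X i \<omega>)} \<union>
    (\<Union>l\<le>n. {\<omega>\<in>space M. real n powr 0.7 \<le>
       \<bar>real (card {i\<in>{1..n}. X i \<omega> \<le> real l / real n}) - real (card {1..n}) * (real l / real n)\<bar>}) \<union>
    (space M - {\<omega>\<in>space M. spaced (1 / real n ^ 3) {1..n} (\<lambda>i. X i \<omega>)})"

lemma good_sample_if_not_bad: "\<omega> \<in> space M \<Longrightarrow> \<omega> \<notin> bad \<Longrightarrow> good_sample n (\<lambda>i. X i \<omega>)"
  using n_ge_1 by (auto simp: bad_def good_sample_def not_le less_imp_le)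

lemma near_boundary_event:
  "{\<omega>\<in>space M. \<exists>i\<in>{1..n}. \<not> (t \<le> X i \<omega> \<and> X i \<omega> \<le> 1 - t)} \<in> events"
  by measurable

lemma deviation_event:
  "{\<omega>\<in>space M. c \<le> \<bar>real (card {i\<in>{1..n}. X i \<omega> \<le> y}) - d\<bar>} \<in> events"
  by measurable

lemma bad_event [measurable]: "bad \<in> events"
  unfolding bad_def
  by (intro sets.Un sets.finite_UN sets.compl_sets near_boundary_event deviation_event
      cluster_measurable spaced_event) auto

lemma prob_bad_le:
  "prob bad \<le> real n * (2 * real n powr (-1.6))
    + (1 / real n powr (-1.6) + 1) * (real n ^ 3 * (2 * real n powr (-1.6)) ^ 3)
    + (1 / real n powr (-1.27) + 1) * (real n ^ 5 * (2 * real n powr (-1.27)) ^ 5)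
    + (real n + 1) * (2 * exp (- 2 * (real n powr 0.7)\<^sup>2 / real n))
    + (1 - (1 - real n * (1 / real n ^ 3)) ^ n)"
proof -
  have n: "real n > 0" using n_ge_1 by simp
  let ?D = "\<lambda>l::nat. {\<omega>\<in>space M. real n powr 0.7 \<le>
       \<bar>real (card {i\<in>{1..n}. X i \<omega> \<le> real l / real n}) - real (card {1..n}) * (real l / real n)\<bar>}"
  have "prob (\<Union>l\<le>n. ?D l) \<le> (\<Sum>l\<le>n. prob (?D l))"
    by (intro finite_measure_subadditive_finite) (use deviation_event in auto)
  also have "\<dots> \<le> (\<Sum>l\<le>n. 2 * exp (- 2 * (real n powr 0.7)\<^sup>2 / real (card {1..n})))"
    by (intro sum_mono prob_empirical_deviation_le) (use n in auto)
  finally have D: "prob (\<Union>l\<le>n. ?D l) \<le> (real n + 1) * (2 * exp (- 2 * (real n powr 0.7)\<^sup>2 / real n))"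
    by (simp add: add.commute)
  have "1 \<le> real n ^ 2" using n_ge_1 by simp
  then have "0 \<le> 1 - real n * (1 / real n ^ 3)"
    using n by (simp add: power2_eq_square power3_eq_cube field_simps)
  then have S: "prob (space M - {\<omega>\<in>space M. spaced (1 / real n ^ 3) {1..n} (\<lambda>i. X i \<omega>)}) \<le>
      1 - (1 - real n * (1 / real n ^ 3)) ^ n"
    using prob_compl[OF spaced_event, of "1 / real n ^ 3"] prob_spaced[of "1 / real n ^ 3"] n
    by (simp add: max_def)
  have B: "prob {\<omega>\<in>space M. \<exists>i\<in>{1..n}. \<not> (real n powr (-1.6) \<le> X i \<omega> \<and> X i \<omega> \<le> 1 - real n powr (-1.6))}
      \<le> real n * (2 * real n powr (-1.6))"
    using prob_near_boundary_le[of "real n powr (-1.6)"] by simp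
  have C: "prob {\<omega>\<in>space M. cluster r (real n powr a) {1..n} (\<lambda>i. X i \<omega>)} \<le>
      (1 / real n powr a + 1) * (real n ^ r * (2 * real n powr a) ^ r)" if "r \<ge> 1" for r a
    using prob_cluster_le[of "real n powr a" r] that n by simp
  have DU: "(\<Union>l\<le>n. ?D l) \<in> events" by (intro sets.finite_UN deviation_event) auto
  note ev = near_boundary_event deviation_event cluster_measurable spaced_event DU
  show ?thesis
    unfolding bad_def
    by (intro order_trans[OF measure_Un_le] add_mono sets.Un sets.compl_sets ev B C D S) simp_all
qed

end

text \<open>The terms are of order \<open>n powr (-0.6)\<close>, \<open>n powr (-0.2)\<close>,
  \<open>n powr (-0.08)\<close>, \<open>n * exp (-2 * n powr 0.4)\<close> and
  \<open>1 / n\<close>.\<close>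

lemma bad_bound_tendsto_0:
  "(\<lambda>n. real n * (2 * real n powr (-1.6))
    + (1 / real n powr (-1.6) + 1) * (real n ^ 3 * (2 * real n powr (-1.6)) ^ 3)
    + (1 / real n powr (-1.27) + 1) * (real n ^ 5 * (2 * real n powr (-1.27)) ^ 5)
    + (real n + 1) * (2 * exp (- 2 * (real n powr 0.7)\<^sup>2 / real n))
    + (1 - (1 - real n * (1 / real n ^ 3)) ^ n)) \<longlonglongrightarrow> 0"
proof -
  have "(\<lambda>n. real n * (2 * real n powr (-1.6))) \<longlonglongrightarrow> 0" by real_asymp
  moreover have "(\<lambda>n. (1 / real n powr (-1.6) + 1) * (real n ^ 3 * (2 * real n powr (-1.6)) ^ 3)) \<longlonglongrightarrow> 0"
    by real_asymp
  moreover have "(\<lambda>n. (1 / real n powr (-1.27) + 1) * (real n ^ 5 * (2 * real n powr (-1.27)) ^ 5)) \<longlonglongrightarrow> 0"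
    by real_asymp
  moreover have "(\<lambda>n. (real n + 1) * (2 * exp (- 2 * (real n powr 0.7)\<^sup>2 / real n))) \<longlonglongrightarrow> 0"
    by real_asymp
  moreover have "(\<lambda>n. 1 - (1 - real n * (1 / real n ^ 3)) ^ n) \<longlonglongrightarrow> 0" by real_asymp
  ultimately have "(\<lambda>n. real n * (2 * real n powr (-1.6))
    + (1 / real n powr (-1.6) + 1) * (real n ^ 3 * (2 * real n powr (-1.6)) ^ 3)
    + (1 / real n powr (-1.27) + 1) * (real n ^ 5 * (2 * real n powr (-1.27)) ^ 5)
    + (real n + 1) * (2 * exp (- 2 * (real n powr 0.7)\<^sup>2 / real n))
    + (1 - (1 - real n * (1 / real n ^ 3)) ^ n)) \<longlonglongrightarrow> 0 + 0 + 0 + 0 + 0"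
    by (intro tendsto_add)
  then show ?thesis by simp
qed

section \<open>Passage to the limit\<close>

text \<open>Up to the bad event and for large \<open>n\<close>, the event of the second limit
  contains spacedness at level \<open>\<tau> / n^2\<close> and is contained in spacedness at level
  \<open>\<sigma> / n^2\<close>, for every positive \<open>\<sigma> < \<tau>\<close>. Each
  \<open>n\<close> may have its own probability space.\<close>

theorem theorem4:
  fixes P :: "nat \<Rightarrow> 'a measure" and U :: "nat \<Rightarrow> nat \<Rightarrow> 'a \<Rightarrow> real"
  assumes prob: "\<And>n. n \<ge> 1 \<Longrightarrow> prob_space (P n)"
    and indep: "\<And>n. n \<ge> 1 \<Longrightarrow> prob_space.indep_vars (P n) (\<lambda>_. borel) (U n) {1..n}"
    and uniform: "\<And>n i. n \<ge> 1 \<Longrightarrow> i \<in> {1..n} \<Longrightarrow>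
                    distr (P n) borel (U n i) = uniform_measure lborel {0..1}"
  shows "(\<lambda>n. measure (P n) {\<omega> \<in> space (P n).
            M_tilde n (\<lambda>i. U n i \<omega>) = M_tilde_plus n (\<lambda>i. U n i \<omega>)}) \<longlonglongrightarrow> 1
       \<and> (\<forall>\<tau>>0. (\<lambda>n. measure (P n) {\<omega> \<in> space (P n).
            M_tilde n (\<lambda>i. U n i \<omega>) \<le> sqrt (real n / \<tau>)}) \<longlonglongrightarrow> exp (- \<tau>))"
proof -
  have sample: "ordered_uniform_sample (P n) n (U n)" if "n \<ge> 1" for n
    unfolding ordered_uniform_sample_def uniform_sample_def uniform_sample_axioms_def
    using that prob indep uniform by auto
  define A where "A \<sigma> n = {\<omega>\<in>space (P n). spaced (\<sigma> / (real n)\<^sup>2) {1..n} (\<lambda>i. U n i \<omega>)}" for \<sigma> n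
  define B where "B n = ordered_uniform_sample.bad (P n) n (U n)" for n
  define E where "E n = {\<omega> \<in> space (P n). M_tilde n (\<lambda>i. U n i \<omega>) = M_tilde_plus n (\<lambda>i. U n i \<omega>)}" for n
  define L where "L \<tau> n = {\<omega> \<in> space (P n). M_tilde n (\<lambda>i. U n i \<omega>) \<le> sqrt (real n / \<tau>)}" for \<tau> n
  have events: "A \<sigma> n \<in> sets (P n)" "B n \<in> sets (P n)" "E n \<in> sets (P n)" "L \<sigma> n \<in> sets (P n)"
    if "n \<ge> 1" for n \<sigma>
  proof -
    interpret ordered_uniform_sample "P n" n "U n" using that by (rule sample)
    show "A \<sigma> n \<in> sets (P n)" "B n \<in> sets (P n)" unfolding A_def B_def by measurable
    show "E n \<in> sets (P n)" "L \<sigma> n \<in> sets (P n)" unfolding E_def L_def by measurable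
  qed
  have B_lim: "(\<lambda>n. measure (P n) (B n)) \<longlonglongrightarrow> 0"
  proof (rule tendsto_sandwich[OF _ _ tendsto_const bad_bound_tendsto_0])
    show "\<forall>\<^sub>F n in sequentially. 0 \<le> measure (P n) (B n)" by simp
    show "\<forall>\<^sub>F n in sequentially. measure (P n) (B n) \<le> real n * (2 * real n powr (-1.6))
      + (1 / real n powr (-1.6) + 1) * (real n ^ 3 * (2 * real n powr (-1.6)) ^ 3)
      + (1 / real n powr (-1.27) + 1) * (real n ^ 5 * (2 * real n powr (-1.27)) ^ 5)
      + (real n + 1) * (2 * exp (- 2 * (real n powr 0.7)\<^sup>2 / real n))
      + (1 - (1 - real n * (1 / real n ^ 3)) ^ n)"
      using eventually_ge_at_top[of 1] unfolding B_def
      by eventually_elim (rule ordered_uniform_sample.prob_bad_le[OF sample])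
  qed
  have A_lim: "(\<lambda>n. measure (P n) (A \<sigma> n)) \<longlonglongrightarrow> exp (- \<sigma>)" if "\<sigma> > 0" for \<sigma>
  proof (rule Lim_transform_eventually[OF tendsto_exp_limit_sequentially])
    \<comment> \<open>From here on the truncation \<open>max 0\<close> in the exact probability is
      inactive.\<close>
    have "\<forall>\<^sub>F n in sequentially. \<sigma> / real n \<le> 1" using that by real_asymp
    then show "\<forall>\<^sub>F n in sequentially. (1 + - \<sigma> / real n) ^ n = measure (P n) (A \<sigma> n)"
      using eventually_ge_at_top[of 1]
    proof eventually_elim
      case (elim n)
      interpret ordered_uniform_sample "P n" n "U n" using elim(2) by (rule sample)
      have "real n * (\<sigma> / (real n)\<^sup>2) = \<sigma> / real n" using elim by (simp add: power2_eq_square)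
      then show ?case
        using prob_spaced[of "\<sigma> / (real n)\<^sup>2"] that elim by (simp add: A_def max_def)
    qed
  qed
  have union: "measure (P n) S \<le> measure (P n) T + measure (P n) (B n)"
    if "n \<ge> 1" "T \<in> sets (P n)" "S \<subseteq> T \<union> B n" for n S T
  proof -
    interpret prob_space "P n" using that(1) by (rule prob)
    have "measure (P n) S \<le> measure (P n) (T \<union> B n)"
      using that events[OF that(1)] by (intro finite_measure_mono) auto
    also have "\<dots> \<le> measure (P n) T + measure (P n) (B n)"
      using that events[OF that(1)] by (intro measure_Un_le) auto
    finally show ?thesis .
  qed
  have good: "good_sample n (\<lambda>i. U n i \<omega>)" if "n \<ge> 1" "\<omega> \<in> space (P n)" "\<omega> \<notin> B n" for n \<omega>
    using that ordered_uniform_sample.good_sample_if_not_bad[OF sample] by (auto simp: B_def)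
  have "(\<lambda>n. measure (P n) (E n)) \<longlonglongrightarrow> 1"
  proof (rule order_tendstoI)
    fix a :: real assume "a < 1"
    \<comment> \<open>So large that the limiting probability \<open>exp (- \<sigma>)\<close> of
      having no short spacing is below \<open>1 - a\<close>.\<close>
    obtain \<sigma> where \<sigma>: "max 0 (- ln (1 - a)) < \<sigma>" using gt_ex by blast
    have "exp (- \<sigma>) < exp (ln (1 - a))" using \<sigma> by (subst exp_less_cancel_iff) auto
    then have a: "a < 1 - (exp (- \<sigma>) + 0)" using \<open>a < 1\<close> by simp
    have "(\<lambda>n. 1 - (measure (P n) (A \<sigma> n) + measure (P n) (B n))) \<longlonglongrightarrow> 1 - (exp (- \<sigma>) + 0)"
      using \<sigma> by (intro tendsto_intros A_lim B_lim) auto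
    from order_tendstoD(1)[OF this a]
    have "\<forall>\<^sub>F n in sequentially. a < 1 - (measure (P n) (A \<sigma> n) + measure (P n) (B n))" .
    \<comment> \<open>The level \<open>\<sigma> + 1\<close> is an arbitrary choice above
      \<open>\<sigma>\<close>.\<close>
    moreover have "\<forall>\<^sub>F n in sequentially. \<forall>u. good_sample n u \<longrightarrow> \<not> spaced (\<sigma> / (real n)\<^sup>2) {1..n} u \<longrightarrow>
        M_tilde n u = M_tilde_plus n u \<and> sqrt (real n / (\<sigma> + 1)) < M_tilde n u"
      using \<sigma> by (intro M_tilde_gt_if_not_spaced) auto
    ultimately show "\<forall>\<^sub>F n in sequentially. a < measure (P n) (E n)"
      using eventually_ge_at_top[of 1]
    proof eventually_elim
      case (elim n)
      interpret prob_space "P n" using elim(3) by (rule prob)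
      have "space (P n) - E n \<subseteq> A \<sigma> n \<union> B n"
        using elim(2) good[OF elim(3)] by (auto simp: A_def E_def)
      from union[OF elim(3) events(1)[OF elim(3)] this]
      show ?case using elim(1) prob_compl[OF events(3)[OF elim(3)]] by linarith
    qed
  next
    fix a :: real assume a: "1 < a"
    show "\<forall>\<^sub>F n in sequentially. measure (P n) (E n) < a"
      using eventually_ge_at_top[of 1]
    proof eventually_elim
      case (elim n)
      interpret prob_space "P n" using elim by (rule prob)
      show ?case using prob_le_1[of "E n"] a by linarith
    qed
  qed
  moreover have "(\<lambda>n. measure (P n) (L \<tau> n)) \<longlonglongrightarrow> exp (- \<tau>)" if \<tau>: "\<tau> > 0" for \<tau>
  proof (rule order_tendstoI)
    fix a :: real assume "a < exp (- \<tau>)"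
    moreover have "(\<lambda>n. measure (P n) (A \<tau> n) - measure (P n) (B n)) \<longlonglongrightarrow> exp (- \<tau>) - 0"
      by (intro tendsto_intros A_lim B_lim \<tau>)
    ultimately have "\<forall>\<^sub>F n in sequentially. a < measure (P n) (A \<tau> n) - measure (P n) (B n)"
      by (intro order_tendstoD(1)) auto
    then show "\<forall>\<^sub>F n in sequentially. a < measure (P n) (L \<tau> n)"
      using M_tilde_le_if_spaced[OF \<tau>] eventually_ge_at_top[of 1]
    proof eventually_elim
      case (elim n)
      have "A \<tau> n \<subseteq> L \<tau> n \<union> B n" using elim(2) good[OF elim(3)] by (auto simp: A_def L_def)
      from union[OF elim(3) events(4)[OF elim(3)] this] show ?case using elim(1) by linarith
    qed
  next
    fix a :: real assume a: "exp (- \<tau>) < a"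
    then have "a > 0" using exp_gt_zero order_less_trans by blast
    then have "- \<tau> < ln a" using a by (metis exp_less_cancel_iff exp_ln)
    \<comment> \<open>Close enough to \<open>\<tau>\<close> that still
      \<open>exp (- \<sigma>) < a\<close>; the maximum with 0 keeps \<open>\<sigma>\<close>
      positive.\<close>
    then obtain \<sigma> where \<sigma>: "max 0 (- ln a) < \<sigma>" "\<sigma> < \<tau>"
      using dense[of "max 0 (- ln a)" \<tau>] \<tau> by auto
    have "exp (- \<sigma>) < exp (ln a)" using \<sigma> by (subst exp_less_cancel_iff) auto
    then have a': "exp (- \<sigma>) + 0 < a" using \<open>a > 0\<close> by simp
    have "(\<lambda>n. measure (P n) (A \<sigma> n) + measure (P n) (B n)) \<longlonglongrightarrow> exp (- \<sigma>) + 0"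
      using \<sigma> by (intro tendsto_intros A_lim B_lim) auto
    moreover have "0 < \<sigma>" using \<sigma> by simp
    ultimately have "\<forall>\<^sub>F n in sequentially. measure (P n) (A \<sigma> n) + measure (P n) (B n) < a"
      using a' by (intro order_tendstoD(2)) auto
    then show "\<forall>\<^sub>F n in sequentially. measure (P n) (L \<tau> n) < a"
      using M_tilde_gt_if_not_spaced[OF \<open>0 < \<sigma>\<close> \<sigma>(2)] eventually_ge_at_top[of 1]
    proof eventually_elim
      case (elim n)
      have "L \<tau> n \<subseteq> A \<sigma> n \<union> B n"
        using elim(2) good[OF elim(3)] by (fastforce simp: A_def L_def)
      from union[OF elim(3) events(1)[OF elim(3)] this] show ?case using elim(1) by linarith
    qed
  qed
  ultimately show ?thesis by (simp add: E_def L_def)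
qed

end
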